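(* For universes \(\mathcal U,\mathcal V\), the statement \(\text{Tarski's-Theorem}_{\mathcal V,\mathcal V^+\sqcup\mathcal U,\mathcal V}\) implies \(\text{Propositional-Resizing}_{\mathcal U,\mathcal V}\). In particular, \(\text{Tarski's-Theorem}_{\mathcal V,\mathcal V^+,\mathcal V}\) implies \(\text{Propositional-Resizing}_{\mathcal V^+,\mathcal V}\).
   Context: Work in univalent foundations (intensional Martin-Löf type theory with universes, \(\mathcal V^+\) the successor universe, \(\mathcal U\sqcup\mathcal V\) the join, function and propositional extensionality, propositional truncations). A poset is a type with a proposition-valued reflexive, transitive, antisymmetric relation. A \(\mathcal V\)-sup-lattice is a poset in which every family \(I\to X\) with \(I:\mathcal V\) has a supremum. \(\text{Tarski's-Theorem}_{\mathcal V,\mathcal U,\mathcal T}\): every monotone endofunction of a \(\mathcal V\)-sup-lattice whose carrier is in \(\mathcal U\) and whose order takes values in \(\mathcal T\) has a greatest fixed point. \(\text{Propositional-Resizing}_{\mathcal U,\mathcal V}\): every proposition \(P:\mathcal U\) is equivalent to some type in \(\mathcal V\). *)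

theory Defs
  imports Main
begin

unbundle lattice_syntax

text \<open>
  HOL is classical and impredicative, so a theorem that derives propositional resizing has content
  only about an object theory. The object theory is embedded deeply: intensional Martin-Loef type
  theory with universes a la Russell, not cumulative, with judgemental equality, and with function
  extensionality, propositional extensionality and propositional truncations postulated. A
  statement of the object theory is a closed type, and it holds if it has a closed inhabitant.
  Univalence, excluded middle, choice and resizing are not among the rules; what is derivable
  remains so when rules are added.
\<close>

section \<open>Universe levels\<close>

text \<open>
  The equations that hold judgementally between universes: \<open>\<squnion>\<close> is associative, commutative
  and idempotent with unit \<open>\<bottom>\<close>, and the successor distributes over it. Strictness excludes
  a universe that contains itself.
\<close>

class universe_level = bounded_semilattice_sup_bot +
  fixes usuc :: "'a \<Rightarrow> 'a"
  assumes less_usuc: "u < usuc u"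
    and usuc_sup: "usuc (u \<squnion> v) = usuc u \<squnion> usuc v"

instantiation nat :: universe_level
begin

definition usuc_nat :: "nat \<Rightarrow> nat" where
  "usuc_nat = Suc"

instance
  by standard (auto simp: usuc_nat_def sup_nat_def)

end

section \<open>Raw terms\<close>

text \<open>
  Only \<open>Pi\<close> and \<open>Lam\<close> bind a variable (de Bruijn indices). Every other type former,
  constructor and eliminator is a constant, indexed by the levels of the universes involved; its
  type is given by \<open>cty\<close> below, where families and motives are functions into a universe.
\<close>

datatype 'l const =
    CSigma 'l 'l | CPair 'l 'l | CSigmaInd 'l 'l 'l
  | CId 'l | CRefl 'l | CJ 'l 'l
  | CSum 'l 'l | CInl 'l 'l | CInr 'l 'l | CSumInd 'l 'l 'l
  | CEmpty 'l | CEmptyInd 'l 'l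
  | CUnit 'l | CStar 'l | CUnitInd 'l 'l
  | CNat | CZero | CSuc | CNatInd 'l
  | CTrunc 'l | CTruncIn 'l | CTruncProp 'l | CTruncRec 'l 'l
  | CFunext 'l 'l
  | CPropext 'l

datatype 'l tm =
    Var nat
  | Univ 'l
  | Pi "'l tm" "'l tm"
  | Lam "'l tm" "'l tm"
  | App "'l tm" "'l tm"
  | Const "'l const"

primrec lift :: "'l tm \<Rightarrow> nat \<Rightarrow> 'l tm" where
  "lift (Var i) k = (if i < k then Var i else Var (Suc i))"
| "lift (Univ u) k = Univ u"
| "lift (Pi A B) k = Pi (lift A k) (lift B (Suc k))"
| "lift (Lam A b) k = Lam (lift A k) (lift b (Suc k))"
| "lift (App f a) k = App (lift f k) (lift a k)"
| "lift (Const c) k = Const c"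

text \<open>\<open>subst t s k\<close> replaces index \<open>k\<close> by \<open>s\<close> and decrements the larger indices.\<close>

primrec subst :: "'l tm \<Rightarrow> 'l tm \<Rightarrow> nat \<Rightarrow> 'l tm" where
  "subst (Var i) s k = (if i < k then Var i else if i = k then s else Var (i - 1))"
| "subst (Univ u) s k = Univ u"
| "subst (Pi A B) s k = Pi (subst A s k) (subst B (lift s 0) (Suc k))"
| "subst (Lam A b) s k = Lam (subst A s k) (subst b (lift s 0) (Suc k))"
| "subst (App f a) s k = App (subst f s k) (subst a s k)"
| "subst (Const c) s k = Const c"

section \<open>Notation for closed terms\<close>

text \<open>
  To write closed terms with named variables, a term is given as a function of the number of
  binders above it: a variable bound below \<open>n\<close> binders has index \<open>m - Suc n\<close> when it is
  used below \<open>m\<close> binders. HOL binders then serve as object binders, without capture. The term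
  denoted by a closed \<open>t\<close> is \<open>t 0\<close>.
\<close>

type_synonym 'l dtm = "nat \<Rightarrow> 'l tm"

definition bound :: "nat \<Rightarrow> 'l dtm" where
  "bound n = (\<lambda>m. Var (m - Suc n))"

definition pi :: "'l dtm \<Rightarrow> ('l dtm \<Rightarrow> 'l dtm) \<Rightarrow> 'l dtm" where
  "pi A B = (\<lambda>n. Pi (A n) (B (bound n) (Suc n)))"

definition lam :: "'l dtm \<Rightarrow> ('l dtm \<Rightarrow> 'l dtm) \<Rightarrow> 'l dtm" where
  "lam A b = (\<lambda>n. Lam (A n) (b (bound n) (Suc n)))"

definition app :: "'l dtm \<Rightarrow> 'l dtm \<Rightarrow> 'l dtm"  (infixl "\<cdot>" 90) where
  "f \<cdot> a = (\<lambda>n. App (f n) (a n))"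

definition univ :: "'l \<Rightarrow> 'l dtm" where
  "univ u = (\<lambda>n. Univ u)"

definition con :: "'l const \<Rightarrow> 'l dtm" where
  "con c = (\<lambda>n. Const c)"

definition arrow :: "'l dtm \<Rightarrow> 'l dtm \<Rightarrow> 'l dtm"  (infixr "\<rightarrow>" 60) where
  "A \<rightarrow> B = pi A (\<lambda>_. B)"

definition sigma :: "'l \<Rightarrow> 'l \<Rightarrow> 'l dtm \<Rightarrow> ('l dtm \<Rightarrow> 'l dtm) \<Rightarrow> 'l dtm" where
  "sigma i j A B = con (CSigma i j) \<cdot> A \<cdot> lam A B"

syntax
  "_pi" :: "pttrn \<Rightarrow> 'l dtm \<Rightarrow> 'l dtm \<Rightarrow> 'l dtm"
    ("(3\<Pi> _:_./ _)" [0, 61, 10] 10)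
  "_sigma" :: "'l \<Rightarrow> 'l \<Rightarrow> pttrn \<Rightarrow> 'l dtm \<Rightarrow> 'l dtm \<Rightarrow> 'l dtm"
    ("(3\<Sigma>\<^bsub>_,_\<^esub> _:_./ _)" [0, 0, 0, 61, 10] 10)
translations
  "\<Pi> x:A. B" \<rightleftharpoons> "CONST pi A (\<lambda>x. B)"
  "\<Sigma>\<^bsub>i,j\<^esub> x:A. B" \<rightleftharpoons> "CONST sigma i j A (\<lambda>x. B)"

text \<open>The subscripts are the levels of the universes in which \<open>A\<close> and \<open>B\<close> live.\<close>

definition prod :: "'l \<Rightarrow> 'l \<Rightarrow> 'l dtm \<Rightarrow> 'l dtm \<Rightarrow> 'l dtm" where
  "prod i j A B = (\<Sigma>\<^bsub>i,j\<^esub> _:A. B)"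

definition eqt :: "'l \<Rightarrow> 'l dtm \<Rightarrow> 'l dtm \<Rightarrow> 'l dtm \<Rightarrow> 'l dtm" where
  "eqt i A x y = con (CId i) \<cdot> A \<cdot> x \<cdot> y"

definition is_prop :: "'l \<Rightarrow> 'l dtm \<Rightarrow> 'l dtm" where
  "is_prop i A = (\<Pi> x:A. \<Pi> y:A. eqt i A x y)"

section \<open>Types of the constants\<close>

text \<open>
  The truncation of a type stays in its universe and eliminates into propositions of every
  universe; the computation rule of \<open>CTruncRec\<close> holds only up to the identity type, because the
  target is a proposition.
\<close>

primrec cty :: "'l::universe_level const \<Rightarrow> 'l dtm" where
  "cty (CSigma i j) =
     (\<Pi> A:univ i. (A \<rightarrow> univ j) \<rightarrow> univ (i \<squnion> j))"
| "cty (CPair i j) =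
     (\<Pi> A:univ i. \<Pi> B:(A \<rightarrow> univ j). \<Pi> a:A. B \<cdot> a \<rightarrow> con (CSigma i j) \<cdot> A \<cdot> B)"
| "cty (CSigmaInd i j k) =
     (\<Pi> A:univ i. \<Pi> B:(A \<rightarrow> univ j). \<Pi> C:(con (CSigma i j) \<cdot> A \<cdot> B \<rightarrow> univ k).
        (\<Pi> a:A. \<Pi> b:B \<cdot> a. C \<cdot> (con (CPair i j) \<cdot> A \<cdot> B \<cdot> a \<cdot> b)) \<rightarrow>
        (\<Pi> p:con (CSigma i j) \<cdot> A \<cdot> B. C \<cdot> p))"
| "cty (CId i) = (\<Pi> A:univ i. A \<rightarrow> A \<rightarrow> univ i)"
| "cty (CRefl i) = (\<Pi> A:univ i. \<Pi> a:A. eqt i A a a)"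
| "cty (CJ i k) =
     (\<Pi> A:univ i. \<Pi> C:(\<Pi> x:A. \<Pi> y:A. eqt i A x y \<rightarrow> univ k).
        (\<Pi> x:A. C \<cdot> x \<cdot> x \<cdot> (con (CRefl i) \<cdot> A \<cdot> x)) \<rightarrow>
        (\<Pi> x:A. \<Pi> y:A. \<Pi> p:eqt i A x y. C \<cdot> x \<cdot> y \<cdot> p))"
| "cty (CSum i j) = univ i \<rightarrow> univ j \<rightarrow> univ (i \<squnion> j)"
| "cty (CInl i j) = (\<Pi> A:univ i. \<Pi> B:univ j. A \<rightarrow> con (CSum i j) \<cdot> A \<cdot> B)"
| "cty (CInr i j) = (\<Pi> A:univ i. \<Pi> B:univ j. B \<rightarrow> con (CSum i j) \<cdot> A \<cdot> B)"
| "cty (CSumInd i j k) =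
     (\<Pi> A:univ i. \<Pi> B:univ j. \<Pi> C:(con (CSum i j) \<cdot> A \<cdot> B \<rightarrow> univ k).
        (\<Pi> a:A. C \<cdot> (con (CInl i j) \<cdot> A \<cdot> B \<cdot> a)) \<rightarrow>
        (\<Pi> b:B. C \<cdot> (con (CInr i j) \<cdot> A \<cdot> B \<cdot> b)) \<rightarrow>
        (\<Pi> z:con (CSum i j) \<cdot> A \<cdot> B. C \<cdot> z))"
| "cty (CEmpty i) = univ i"
| "cty (CEmptyInd i k) =
     (\<Pi> C:(con (CEmpty i) \<rightarrow> univ k). \<Pi> z:con (CEmpty i). C \<cdot> z)"
| "cty (CUnit i) = univ i"
| "cty (CStar i) = con (CUnit i)"
| "cty (CUnitInd i k) =
     (\<Pi> C:(con (CUnit i) \<rightarrow> univ k).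
        C \<cdot> con (CStar i) \<rightarrow> (\<Pi> z:con (CUnit i). C \<cdot> z))"
| "cty CNat = univ \<bottom>"
| "cty CZero = con CNat"
| "cty CSuc = con CNat \<rightarrow> con CNat"
| "cty (CNatInd k) =
     (\<Pi> C:(con CNat \<rightarrow> univ k).
        C \<cdot> con CZero \<rightarrow>
        (\<Pi> n:con CNat. C \<cdot> n \<rightarrow> C \<cdot> (con CSuc \<cdot> n)) \<rightarrow>
        (\<Pi> n:con CNat. C \<cdot> n))"
| "cty (CTrunc i) = univ i \<rightarrow> univ i"
| "cty (CTruncIn i) = (\<Pi> A:univ i. A \<rightarrow> con (CTrunc i) \<cdot> A)"
| "cty (CTruncProp i) = (\<Pi> A:univ i. is_prop i (con (CTrunc i) \<cdot> A))"
| "cty (CTruncRec i j) =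
     (\<Pi> A:univ i. \<Pi> P:univ j.
        is_prop j P \<rightarrow> (A \<rightarrow> P) \<rightarrow> con (CTrunc i) \<cdot> A \<rightarrow> P)"
| "cty (CFunext i j) =
     (\<Pi> A:univ i. \<Pi> B:(A \<rightarrow> univ j). \<Pi> f:(\<Pi> x:A. B \<cdot> x). \<Pi> g:(\<Pi> x:A. B \<cdot> x).
        (\<Pi> x:A. eqt j (B \<cdot> x) (f \<cdot> x) (g \<cdot> x)) \<rightarrow>
        eqt (i \<squnion> j) (\<Pi> x:A. B \<cdot> x) f g)"
| "cty (CPropext i) =
     (\<Pi> P:univ i. \<Pi> Q:univ i.
        is_prop i P \<rightarrow> is_prop i Q \<rightarrow> (P \<rightarrow> Q) \<rightarrow> (Q \<rightarrow> P) \<rightarrow>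
        eqt (usuc i) (univ i) P Q)"

section \<open>Judgements\<close>

definition apps :: "'l tm \<Rightarrow> 'l tm list \<Rightarrow> 'l tm" where
  "apps = foldl App"

inductive comp :: "'l tm \<Rightarrow> 'l tm \<Rightarrow> bool" where
  "comp (apps (Const (CSigmaInd i j k)) [A, B, C, d, apps (Const (CPair i j)) [A, B, a, b]])
     (apps d [a, b])"
| "comp (apps (Const (CJ i k)) [A, C, d, a, a, apps (Const (CRefl i)) [A, a]])
     (App d a)"
| "comp (apps (Const (CSumInd i j k)) [A, B, C, d, e, apps (Const (CInl i j)) [A, B, a]])
     (App d a)"
| "comp (apps (Const (CSumInd i j k)) [A, B, C, d, e, apps (Const (CInr i j)) [A, B, b]])
     (App e b)"
| "comp (apps (Const (CUnitInd i k)) [C, d, Const (CStar i)]) d"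
| "comp (apps (Const (CNatInd k)) [C, d, e, Const CZero]) d"
| "comp (apps (Const (CNatInd k)) [C, d, e, App (Const CSuc) n])
     (apps e [n, apps (Const (CNatInd k)) [C, d, e, n]])"

text \<open>
  Contexts list the innermost variable first, so the type of variable \<open>i\<close> has to be lifted over
  the \<open>Suc i\<close> most recent entries.
\<close>

inductive wf_ctx :: "'l::universe_level tm list \<Rightarrow> bool"  ("\<turnstile> _" [50] 50)
  and typing :: "'l tm list \<Rightarrow> 'l tm \<Rightarrow> 'l tm \<Rightarrow> bool"  ("_ \<turnstile> _ \<^bold>: _" [50, 50, 50] 50)
  and equality :: "'l tm list \<Rightarrow> 'l tm \<Rightarrow> 'l tm \<Rightarrow> 'l tm \<Rightarrow> bool"
    ("_ \<turnstile> _ \<doteq> _ \<^bold>: _" [50, 50, 50, 50] 50)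
  where
  wf_nil: "\<turnstile> []"
| wf_cons: "\<turnstile> \<Gamma> \<Longrightarrow> \<Gamma> \<turnstile> A \<^bold>: Univ u \<Longrightarrow> \<turnstile> A # \<Gamma>"

| ty_var: "\<turnstile> \<Gamma> \<Longrightarrow> i < length \<Gamma> \<Longrightarrow> \<Gamma> \<turnstile> Var i \<^bold>: ((\<lambda>A. lift A 0) ^^ Suc i) (\<Gamma> ! i)"
| ty_univ: "\<turnstile> \<Gamma> \<Longrightarrow> \<Gamma> \<turnstile> Univ u \<^bold>: Univ (usuc u)"
| ty_pi: "\<Gamma> \<turnstile> A \<^bold>: Univ u \<Longrightarrow> A # \<Gamma> \<turnstile> B \<^bold>: Univ v \<Longrightarrow> \<Gamma> \<turnstile> Pi A B \<^bold>: Univ (u \<squnion> v)"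
| ty_lam: "\<Gamma> \<turnstile> A \<^bold>: Univ u \<Longrightarrow> A # \<Gamma> \<turnstile> b \<^bold>: B \<Longrightarrow> \<Gamma> \<turnstile> Lam A b \<^bold>: Pi A B"
| ty_app: "\<Gamma> \<turnstile> f \<^bold>: Pi A B \<Longrightarrow> \<Gamma> \<turnstile> a \<^bold>: A \<Longrightarrow> \<Gamma> \<turnstile> App f a \<^bold>: subst B a 0"
| ty_const: "\<turnstile> \<Gamma> \<Longrightarrow> \<Gamma> \<turnstile> Const c \<^bold>: cty c 0"
| ty_conv: "\<Gamma> \<turnstile> t \<^bold>: A \<Longrightarrow> \<Gamma> \<turnstile> A \<doteq> B \<^bold>: Univ u \<Longrightarrow> \<Gamma> \<turnstile> t \<^bold>: B"

| eq_refl: "\<Gamma> \<turnstile> t \<^bold>: A \<Longrightarrow> \<Gamma> \<turnstile> t \<doteq> t \<^bold>: A"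
| eq_sym: "\<Gamma> \<turnstile> s \<doteq> t \<^bold>: A \<Longrightarrow> \<Gamma> \<turnstile> t \<doteq> s \<^bold>: A"
| eq_trans: "\<Gamma> \<turnstile> r \<doteq> s \<^bold>: A \<Longrightarrow> \<Gamma> \<turnstile> s \<doteq> t \<^bold>: A \<Longrightarrow> \<Gamma> \<turnstile> r \<doteq> t \<^bold>: A"
| eq_conv: "\<Gamma> \<turnstile> s \<doteq> t \<^bold>: A \<Longrightarrow> \<Gamma> \<turnstile> A \<doteq> B \<^bold>: Univ u \<Longrightarrow> \<Gamma> \<turnstile> s \<doteq> t \<^bold>: B"
| eq_pi: "\<Gamma> \<turnstile> A \<^bold>: Univ u \<Longrightarrow> \<Gamma> \<turnstile> A \<doteq> A' \<^bold>: Univ u \<Longrightarrow> A # \<Gamma> \<turnstile> B \<doteq> B' \<^bold>: Univ v \<Longrightarrow>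
    \<Gamma> \<turnstile> Pi A B \<doteq> Pi A' B' \<^bold>: Univ (u \<squnion> v)"
| eq_lam: "\<Gamma> \<turnstile> A \<^bold>: Univ u \<Longrightarrow> \<Gamma> \<turnstile> A \<doteq> A' \<^bold>: Univ u \<Longrightarrow> A # \<Gamma> \<turnstile> b \<doteq> b' \<^bold>: B \<Longrightarrow>
    \<Gamma> \<turnstile> Lam A b \<doteq> Lam A' b' \<^bold>: Pi A B"
| eq_app: "\<Gamma> \<turnstile> f \<doteq> f' \<^bold>: Pi A B \<Longrightarrow> \<Gamma> \<turnstile> a \<doteq> a' \<^bold>: A \<Longrightarrow>
    \<Gamma> \<turnstile> App f a \<doteq> App f' a' \<^bold>: subst B a 0"
| eq_beta: "\<Gamma> \<turnstile> A \<^bold>: Univ u \<Longrightarrow> A # \<Gamma> \<turnstile> b \<^bold>: B \<Longrightarrow> \<Gamma> \<turnstile> a \<^bold>: A \<Longrightarrow>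
    \<Gamma> \<turnstile> App (Lam A b) a \<doteq> subst b a 0 \<^bold>: subst B a 0"
| eq_eta: "\<Gamma> \<turnstile> f \<^bold>: Pi A B \<Longrightarrow> \<Gamma> \<turnstile> Lam A (App (lift f 0) (Var 0)) \<doteq> f \<^bold>: Pi A B"
| eq_comp: "\<Gamma> \<turnstile> s \<^bold>: A \<Longrightarrow> \<Gamma> \<turnstile> t \<^bold>: A \<Longrightarrow> comp s t \<Longrightarrow> \<Gamma> \<turnstile> s \<doteq> t \<^bold>: A"

definition holds :: "'l::universe_level dtm \<Rightarrow> bool" where
  "holds A \<longleftrightarrow> (\<exists>t. [] \<turnstile> t \<^bold>: A 0)"

section \<open>Posets and suprema\<close>

text \<open>
  Below, the carrier \<open>X\<close> is in universe \<open>u\<close>, the order \<open>le\<close> takes values in universe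
  \<open>t\<close>, and families are indexed by types in universe \<open>v\<close>. Suprema and greatest fixed points
  are unique by antisymmetry, so asking for them with \<open>\<Sigma>\<close> states a property.
\<close>

definition prop_valued :: "'l \<Rightarrow> 'l dtm \<Rightarrow> 'l dtm \<Rightarrow> 'l dtm" where
  "prop_valued t X le = (\<Pi> x:X. \<Pi> y:X. is_prop t (le \<cdot> x \<cdot> y))"

definition reflexive :: "'l dtm \<Rightarrow> 'l dtm \<Rightarrow> 'l dtm" where
  "reflexive X le = (\<Pi> x:X. le \<cdot> x \<cdot> x)"

definition transitive :: "'l dtm \<Rightarrow> 'l dtm \<Rightarrow> 'l dtm" where
  "transitive X le = (\<Pi> x:X. \<Pi> y:X. \<Pi> z:X. le \<cdot> x \<cdot> y \<rightarrow> le \<cdot> y \<cdot> z \<rightarrow> le \<cdot> x \<cdot> z)"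

definition antisymmetric :: "'l \<Rightarrow> 'l dtm \<Rightarrow> 'l dtm \<Rightarrow> 'l dtm" where
  "antisymmetric u X le = (\<Pi> x:X. \<Pi> y:X. le \<cdot> x \<cdot> y \<rightarrow> le \<cdot> y \<cdot> x \<rightarrow> eqt u X x y)"

definition is_poset :: "'l::universe_level \<Rightarrow> 'l \<Rightarrow> 'l dtm \<Rightarrow> 'l dtm \<Rightarrow> 'l dtm" where
  "is_poset u t X le =
     prod (u \<squnion> t) (u \<squnion> t) (prop_valued t X le)
       (prod (u \<squnion> t) (u \<squnion> t) (reflexive X le)
         (prod (u \<squnion> t) (u \<squnion> t) (transitive X le) (antisymmetric u X le)))"

definition is_sup ::
  "'l::universe_level \<Rightarrow> 'l \<Rightarrow> 'l \<Rightarrow> 'l dtm \<Rightarrow> 'l dtm \<Rightarrow> 'l dtm \<Rightarrow> 'l dtm \<Rightarrow> 'l dtm \<Rightarrow> 'l dtm"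
  where
  "is_sup v u t X le I \<alpha> s =
     prod (v \<squnion> t) (v \<squnion> u \<squnion> t)
       (\<Pi> i:I. le \<cdot> (\<alpha> \<cdot> i) \<cdot> s)
       (\<Pi> y:X. (\<Pi> i:I. le \<cdot> (\<alpha> \<cdot> i) \<cdot> y) \<rightarrow> le \<cdot> s \<cdot> y)"

definition has_sups :: "'l::universe_level \<Rightarrow> 'l \<Rightarrow> 'l \<Rightarrow> 'l dtm \<Rightarrow> 'l dtm \<Rightarrow> 'l dtm" where
  "has_sups v u t X le =
     (\<Pi> I:univ v. \<Pi> \<alpha>:(I \<rightarrow> X). \<Sigma>\<^bsub>u,v \<squnion> u \<squnion> t\<^esub> s:X. is_sup v u t X le I \<alpha> s)"

definition monotone_endo :: "'l dtm \<Rightarrow> 'l dtm \<Rightarrow> 'l dtm \<Rightarrow> 'l dtm" where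
  "monotone_endo X le f = (\<Pi> x:X. \<Pi> y:X. le \<cdot> x \<cdot> y \<rightarrow> le \<cdot> (f \<cdot> x) \<cdot> (f \<cdot> y))"

definition greatest_fixed_point ::
  "'l::universe_level \<Rightarrow> 'l \<Rightarrow> 'l dtm \<Rightarrow> 'l dtm \<Rightarrow> 'l dtm \<Rightarrow> 'l dtm" where
  "greatest_fixed_point u t X le f =
     (\<Sigma>\<^bsub>u,u \<squnion> t\<^esub> x:X. prod u (u \<squnion> t)
        (eqt u X (f \<cdot> x) x)
        (\<Pi> y:X. eqt u X (f \<cdot> y) y \<rightarrow> le \<cdot> y \<cdot> x))"

definition Tarskis_Theorem :: "'l::universe_level \<Rightarrow> 'l \<Rightarrow> 'l \<Rightarrow> 'l dtm" where
  "Tarskis_Theorem v u t =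
     (\<Pi> X:univ u. \<Pi> le:(X \<rightarrow> X \<rightarrow> univ t).
        is_poset u t X le \<rightarrow> has_sups v u t X le \<rightarrow>
        (\<Pi> f:(X \<rightarrow> X). monotone_endo X le f \<rightarrow> greatest_fixed_point u t X le f))"

section \<open>Equivalences and resizing\<close>

definition is_contr :: "'l \<Rightarrow> 'l dtm \<Rightarrow> 'l dtm" where
  "is_contr i A = (\<Sigma>\<^bsub>i,i\<^esub> c:A. \<Pi> x:A. eqt i A c x)"

definition fiber :: "'l \<Rightarrow> 'l \<Rightarrow> 'l dtm \<Rightarrow> 'l dtm \<Rightarrow> 'l dtm \<Rightarrow> 'l dtm \<Rightarrow> 'l dtm" where
  "fiber i j A B f b = (\<Sigma>\<^bsub>i,j\<^esub> a:A. eqt j B (f \<cdot> a) b)"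

definition is_equiv :: "'l::universe_level \<Rightarrow> 'l \<Rightarrow> 'l dtm \<Rightarrow> 'l dtm \<Rightarrow> 'l dtm \<Rightarrow> 'l dtm" where
  "is_equiv i j A B f = (\<Pi> b:B. is_contr (i \<squnion> j) (fiber i j A B f b))"

definition equivalent :: "'l::universe_level \<Rightarrow> 'l \<Rightarrow> 'l dtm \<Rightarrow> 'l dtm \<Rightarrow> 'l dtm" where
  "equivalent i j A B = (\<Sigma>\<^bsub>i \<squnion> j,i \<squnion> j\<^esub> f:(A \<rightarrow> B). is_equiv i j A B f)"

definition Propositional_Resizing :: "'l::universe_level \<Rightarrow> 'l \<Rightarrow> 'l dtm" where
  "Propositional_Resizing u v =
     (\<Pi> P:univ u. is_prop u P \<rightarrow> (\<Sigma>\<^bsub>usuc v,u \<squnion> v\<^esub> Q:univ v. equivalent u v P Q))"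

end

theory Submission
  imports Defs
begin

text \<open>
  Let \<open>P\<close> be a proposition. Its small parts, the pairs of a proposition \<open>Q\<close> of the
  small universe \<open>\<V>\<close> and a map \<open>Q \<rightarrow> P\<close>, form a \<open>\<V>\<close>-sup-lattice under implication: since
  \<open>P\<close> is a proposition, the supremum of a family is the truncation of the sum of its members.
  The greatest fixed point of the identity is a greatest small part. It implies \<open>P\<close>, and if
  \<open>P\<close> holds then the unit type is a small part, so the greatest one is inhabited.

  The derivations of the object theory are found by a type checker that is proved sound against
  the typing rules. It uses no metatheory of the calculus (weakening, substitution, subject reduction):
  a reduction step is performed only after the types that the corresponding rule mentions have been
  inferred. The checker runs on terms whose levels are concrete, and the derivation is transported
  along a homomorphism of levels.
\<close>

section \<open>A type checker\<close>

fun shift :: "nat \<Rightarrow> nat \<Rightarrow> nat \<Rightarrow> nat" where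
  "shift i 0 j = i + j"
| "shift 0 (Suc k) j = 0"
| "shift (Suc i) (Suc k) j = Suc (shift i k j)"

primrec lift_by :: "nat \<Rightarrow> 'l tm \<Rightarrow> nat \<Rightarrow> 'l tm" where
  "lift_by j (Var i) k = Var (shift i k j)"
| "lift_by j (Univ u) k = Univ u"
| "lift_by j (Pi A B) k = Pi (lift_by j A k) (lift_by j B (Suc k))"
| "lift_by j (Lam A b) k = Lam (lift_by j A k) (lift_by j b (Suc k))"
| "lift_by j (App f a) k = App (lift_by j f k) (lift_by j a k)"
| "lift_by j (Const c) k = Const c"

lemma shift_eq: "shift i k j = (if i < k then i else i + j)"
  by (induction i k j rule: shift.induct) auto

lemma lift_by_0 [simp]: "lift_by 0 t k = t"
  by (induction t arbitrary: k) (auto simp: shift_eq)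

lemma lift_lift_by: "lift (lift_by j t k) k = lift_by (Suc j) t k"
  by (induction t arbitrary: k) (auto simp: shift_eq)

lemma funpow_lift: "((\<lambda>A. lift A 0) ^^ j) t = lift_by j t 0"
  by (induction j) (auto simp: lift_lift_by)

fun subst_var :: "nat \<Rightarrow> nat \<Rightarrow> nat \<Rightarrow> nat \<Rightarrow> 'l tm \<Rightarrow> 'l tm" where
  "subst_var 0 0 i k s = lift_by k s 0"
| "subst_var 0 (Suc b) i k s = Var i"
| "subst_var (Suc a) 0 i k s = Var (i - Suc 0)"
| "subst_var (Suc a) (Suc b) i k s = subst_var a b i k s"

text \<open>\<open>subst\<close> lifts its argument again at every binder. Here the lifting is
  postponed to the replaced variable, where it is done once for all \<open>k\<close> binders
  passed.\<close>

primrec subst_at :: "'l tm \<Rightarrow> 'l tm \<Rightarrow> nat \<Rightarrow> 'l tm" where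
  "subst_at (Var i) s k = subst_var i k i k s"
| "subst_at (Univ u) s k = Univ u"
| "subst_at (Pi A B) s k = Pi (subst_at A s k) (subst_at B s (Suc k))"
| "subst_at (Lam A b) s k = Lam (subst_at A s k) (subst_at b s (Suc k))"
| "subst_at (App f a) s k = App (subst_at f s k) (subst_at a s k)"
| "subst_at (Const c) s k = Const c"

lemma subst_var_eq:
  "subst_var a b i k s = (if a < b then Var i else if a = b then lift_by k s 0 else Var (i - 1))"
  by (induction a b i k s rule: subst_var.induct) auto

lemma subst_lift_by: "subst t (lift_by k s 0) k = subst_at t s k"
  by (induction t arbitrary: k) (auto simp: subst_var_eq lift_lift_by)

lemma subst_at_0: "subst_at t s 0 = subst t s 0"
  using subst_lift_by[of t 0 s] by simp

section \<open>Application spines and the computation rules\<close>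

primrec spine :: "'l tm \<Rightarrow> 'l tm list \<Rightarrow> 'l tm \<times> 'l tm list" where
  "spine (Var i) as = (Var i, as)"
| "spine (Univ u) as = (Univ u, as)"
| "spine (Pi A B) as = (Pi A B, as)"
| "spine (Lam A b) as = (Lam A b, as)"
| "spine (App f a) as = spine f (a # as)"
| "spine (Const c) as = (Const c, as)"

lemma spine_apps: "spine t as = (h, bs) \<Longrightarrow> apps t as = apps h bs"
  by (induction t arbitrary: as) (fastforce simp: apps_def)+

fun guard :: "bool \<Rightarrow> 'a \<Rightarrow> 'a option" where
  "guard True x = Some x"
| "guard False x = None"

lemma guard_eq_Some [simp]: "guard P x = Some y \<longleftrightarrow> P \<and> x = y"
  by (cases P) auto

text \<open>The rules of \<open>comp\<close> repeat the parameters of the eliminator in the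
  constructor. The repetition is tested syntactically: a redex up to judgemental equality may be
  missed, but no false one is accepted.\<close>

fun iota_pair :: "'l \<Rightarrow> 'l \<Rightarrow> 'l tm \<Rightarrow> 'l tm \<Rightarrow> 'l tm \<Rightarrow> 'l tm \<times> 'l tm list \<Rightarrow> 'l tm option" where
  "iota_pair i j A B d (h, [A', B', a, b]) =
     guard (h = Const (CPair i j) \<and> A' = A \<and> B' = B) (App (App d a) b)"
| "iota_pair i j A B d _ = None"

fun iota_refl :: "'l \<Rightarrow> 'l tm \<Rightarrow> 'l tm \<Rightarrow> 'l tm \<Rightarrow> 'l tm \<Rightarrow> 'l tm \<times> 'l tm list \<Rightarrow> 'l tm option" where
  "iota_refl i A d x y (h, [A', a]) =
     guard (h = Const (CRefl i) \<and> A' = A \<and> x = a \<and> y = a) (App d a)"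
| "iota_refl i A d x y _ = None"

lemma iota_pair_SomeD:
  "iota_pair i j A B d x = Some t \<Longrightarrow>
     \<exists>a b. x = (Const (CPair i j), [A, B, a, b]) \<and> t = App (App d a) b"
  by (induction i j A B d x rule: iota_pair.induct) auto

lemma iota_refl_SomeD:
  "iota_refl i A d x y z = Some t \<Longrightarrow>
     \<exists>a. z = (Const (CRefl i), [A, a]) \<and> t = App d a \<and> x = a \<and> y = a"
  by (induction i A d x y z rule: iota_refl.induct) auto

fun iota_const :: "'l const \<Rightarrow> 'l tm list \<Rightarrow> 'l tm option" where
  "iota_const (CSigmaInd i j k) [A, B, C, d, p] = iota_pair i j A B d (spine p [])"
| "iota_const (CJ i k) [A, C, d, x, y, p] = iota_refl i A d x y (spine p [])"
| "iota_const c as = None"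

fun iota :: "'l tm \<times> 'l tm list \<Rightarrow> 'l tm option" where
  "iota (Const c, as) = iota_const c as"
| "iota (h, as) = None"

lemma iota_comp:
  assumes "iota (spine s []) = Some t"
  shows "comp s t"
proof -
  obtain c as where s: "spine s [] = (Const c, as)" and t: "iota_const c as = Some t"
    using assms by (auto elim: iota.elims)
  have s': "s = apps (Const c) as"
    using spine_apps[OF s] by (simp add: apps_def)
  show ?thesis
    using t
  proof (cases rule: iota_const.elims)
    case (1 i j k A B C d p)
    then obtain a b where "spine p [] = (Const (CPair i j), [A, B, a, b])" "t = App (App d a) b"
      using iota_pair_SomeD[OF 1(3)[symmetric]] by blast
    then show ?thesis
      using 1 s' spine_apps[of p "[]"] comp.intros(1)[of i j k A B C d a b] by (simp add: apps_def)
  next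
    case (2 i k A C d x y p)
    then obtain a where "spine p [] = (Const (CRefl i), [A, a])" "t = App d a" "x = a" "y = a"
      using iota_refl_SomeD[OF 2(3)[symmetric]] by blast
    then show ?thesis
      using 2 s' spine_apps[of p "[]"] comp.intros(2)[of i k A C d a] by (simp add: apps_def)
  qed auto
qed

text \<open>Counts the arguments in front of the scrutinee. The value 0 for the other constants
  matches no spine in \<open>red_spine\<close>, whose function part is itself an
  application.\<close>

fun elim_arity :: "'l const \<Rightarrow> nat" where
  "elim_arity (CSigmaInd i j k) = Suc (Suc (Suc (Suc 0)))"
| "elim_arity (CJ i k) = Suc (Suc (Suc (Suc (Suc 0))))"
| "elim_arity c = 0"

fun elim_spine :: "'l tm \<times> 'l tm list \<Rightarrow> bool" where
  "elim_spine (Const c, as) = (length as = elim_arity c)"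
| "elim_spine (h, as) = False"

text \<open>
  An answer \<open>(t, T)\<close> to a query with subject \<open>s\<close> claims \<open>s \<^bold>: T\<close> and \<open>s \<doteq> t \<^bold>: T\<close>. The functions below
  are defined by constructor patterns and pass intermediate answers as arguments, because the
  simplifier, which has to run them, traverses the scrutinee of every \<open>if\<close> and \<open>case\<close> again.
\<close>

datatype 'l query = Infer "'l tm" | Red "'l tm" | Whd "'l tm" | Eqv "'l tm" "'l tm"

primrec subject :: "'l query \<Rightarrow> 'l tm" where
  "subject (Infer t) = t"
| "subject (Red t) = t"
| "subject (Whd t) = t"
| "subject (Eqv s t) = s"

type_synonym 'l answer = "('l tm \<times> 'l tm) option"
type_synonym 'l solver = "'l tm list \<Rightarrow> 'l query \<Rightarrow> 'l answer"

section \<open>Types compared with universes and with function types\<close>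

fun answer_univ :: "'l answer \<Rightarrow> 'l option" where
  "answer_univ (Some (Univ u, Univ v)) = Some u"
| "answer_univ _ = None"

fun as_univ :: "'l solver \<Rightarrow> 'l tm list \<Rightarrow> 'l tm \<Rightarrow> 'l option" where
  "as_univ r \<Gamma> (Univ u) = Some u"
| "as_univ r \<Gamma> T = answer_univ (r \<Gamma> (Whd T))"

fun answer_pi :: "'l answer \<Rightarrow> ('l tm \<times> 'l tm) option" where
  "answer_pi (Some (Pi A B, Univ v)) = Some (A, B)"
| "answer_pi _ = None"

fun as_pi :: "'l solver \<Rightarrow> 'l tm list \<Rightarrow> 'l tm \<Rightarrow> ('l tm \<times> 'l tm) option" where
  "as_pi r \<Gamma> (Pi A B) = Some (A, B)"
| "as_pi r \<Gamma> T = answer_pi (r \<Gamma> (Whd T))"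

fun univ_of :: "'l solver \<Rightarrow> 'l tm list \<Rightarrow> 'l answer \<Rightarrow> 'l option" where
  "univ_of r \<Gamma> (Some (t, S)) = as_univ r \<Gamma> S"
| "univ_of r \<Gamma> None = None"

definition sort_of :: "'l solver \<Rightarrow> 'l tm list \<Rightarrow> 'l tm \<Rightarrow> 'l option" where
  "sort_of r \<Gamma> A = univ_of r \<Gamma> (r \<Gamma> (Infer A))"

definition eq_sort :: "'l solver \<Rightarrow> 'l tm list \<Rightarrow> 'l tm \<Rightarrow> 'l tm \<Rightarrow> 'l option" where
  "eq_sort r \<Gamma> A B = univ_of r \<Gamma> (r \<Gamma> (Eqv A B))"

fun conv_unless :: "bool \<Rightarrow> 'l solver \<Rightarrow> 'l tm list \<Rightarrow> 'l tm \<Rightarrow> 'l tm \<Rightarrow> bool" where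
  "conv_unless True r \<Gamma> A B = True"
| "conv_unless False r \<Gamma> A B = (\<not> Option.is_none (eq_sort r \<Gamma> A B))"

definition conv :: "'l solver \<Rightarrow> 'l tm list \<Rightarrow> 'l tm \<Rightarrow> 'l tm \<Rightarrow> bool" where
  "conv r \<Gamma> A B = conv_unless (A = B) r \<Gamma> A B"

fun answer_conv :: "'l solver \<Rightarrow> 'l tm list \<Rightarrow> 'l tm \<Rightarrow> 'l answer \<Rightarrow> bool" where
  "answer_conv r \<Gamma> A (Some (t, B)) = conv r \<Gamma> B A"
| "answer_conv r \<Gamma> A None = False"

definition check :: "'l solver \<Rightarrow> 'l tm list \<Rightarrow> 'l tm \<Rightarrow> 'l tm \<Rightarrow> bool" where
  "check r \<Gamma> t A = answer_conv r \<Gamma> A (r \<Gamma> (Infer t))"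

section \<open>Type inference\<close>

fun lookup :: "'l tm list \<Rightarrow> nat \<Rightarrow> nat \<Rightarrow> 'l tm option" where
  "lookup [] i j = None"
| "lookup (A # \<Gamma>) 0 j = Some (lift_by j A 0)"
| "lookup (A # \<Gamma>) (Suc i) j = lookup \<Gamma> i (Suc j)"

fun pi_sort :: "'l::universe_level option \<Rightarrow> 'l option \<Rightarrow> 'l tm option" where
  "pi_sort (Some u) (Some v) = Some (Univ (u \<squnion> v))"
| "pi_sort _ _ = None"

fun lam_type :: "'l tm \<Rightarrow> 'l option \<Rightarrow> 'l answer \<Rightarrow> 'l tm option" where
  "lam_type A (Some u) (Some (t, B)) = Some (Pi A B)"
| "lam_type A _ _ = None"

fun app_type :: "'l solver \<Rightarrow> 'l tm list \<Rightarrow> 'l tm \<Rightarrow> ('l tm \<times> 'l tm) option \<Rightarrow> 'l tm option" where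
  "app_type r \<Gamma> a (Some (A, B)) = guard (check r \<Gamma> a A) (subst_at B a 0)"
| "app_type r \<Gamma> a None = None"

fun infer_app :: "'l solver \<Rightarrow> 'l tm list \<Rightarrow> 'l tm \<Rightarrow> 'l answer \<Rightarrow> 'l tm option" where
  "infer_app r \<Gamma> a (Some (f, F)) = app_type r \<Gamma> a (as_pi r \<Gamma> F)"
| "infer_app r \<Gamma> a None = None"

primrec infer :: "'l::universe_level solver \<Rightarrow> 'l tm list \<Rightarrow> 'l tm \<Rightarrow> 'l tm option" where
  "infer r \<Gamma> (Var i) = lookup \<Gamma> i (Suc 0)"
| "infer r \<Gamma> (Univ u) = Some (Univ (usuc u))"
| "infer r \<Gamma> (Pi A B) = pi_sort (sort_of r \<Gamma> A) (sort_of r (A # \<Gamma>) B)"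
| "infer r \<Gamma> (Lam A b) = lam_type A (sort_of r \<Gamma> A) (r (A # \<Gamma>) (Infer b))"
| "infer r \<Gamma> (App f a) = infer_app r \<Gamma> a (r \<Gamma> (Infer f))"
| "infer r \<Gamma> (Const c) = Some (cty c 0)"

section \<open>One step of weak head reduction\<close>

fun beta :: "'l tm \<Rightarrow> 'l tm \<Rightarrow> 'l option \<Rightarrow> 'l answer \<Rightarrow> bool \<Rightarrow> 'l answer" where
  "beta b a (Some u) (Some (t, B)) True = Some (subst_at b a 0, subst_at B a 0)"
| "beta b a _ _ _ = None"

text \<open>Rule \<open>eq_comp\<close> asks for both sides at one type. The contractum is checked
  against the type inferred for the redex, which replaces an appeal to subject reduction.\<close>

fun retype :: "'l solver \<Rightarrow> 'l tm list \<Rightarrow> 'l tm \<Rightarrow> 'l answer \<Rightarrow> 'l answer" where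
  "retype r \<Gamma> t (Some (s, T)) = guard (check r \<Gamma> t T) (t, T)"
| "retype r \<Gamma> t None = None"

fun red_arg' ::
  "'l solver \<Rightarrow> 'l tm list \<Rightarrow> 'l tm \<Rightarrow> 'l tm \<Rightarrow> 'l tm \<Rightarrow>
    'l tm \<Rightarrow> ('l tm \<times> 'l tm) option \<Rightarrow> 'l answer" where
  "red_arg' r \<Gamma> f a a' A' (Some (A, B)) = guard (conv r \<Gamma> A' A) (App f a', subst_at B a 0)"
| "red_arg' r \<Gamma> f a a' A' None = None"

fun answer_as_pi :: "'l solver \<Rightarrow> 'l tm list \<Rightarrow> 'l answer \<Rightarrow> ('l tm \<times> 'l tm) option" where
  "answer_as_pi r \<Gamma> (Some (t, T)) = as_pi r \<Gamma> T"
| "answer_as_pi r \<Gamma> None = None"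

fun red_arg :: "'l solver \<Rightarrow> 'l tm list \<Rightarrow> 'l tm \<Rightarrow> 'l tm \<Rightarrow> 'l answer \<Rightarrow> 'l answer" where
  "red_arg r \<Gamma> f a (Some (a', A')) = red_arg' r \<Gamma> f a a' A' (answer_as_pi r \<Gamma> (r \<Gamma> (Infer f)))"
| "red_arg r \<Gamma> f a None = None"

fun red_fun' :: "'l solver \<Rightarrow> 'l tm list \<Rightarrow> 'l tm \<Rightarrow> 'l tm \<Rightarrow> ('l tm \<times> 'l tm) option \<Rightarrow> 'l answer" where
  "red_fun' r \<Gamma> f' a (Some (A, B)) = guard (check r \<Gamma> a A) (App f' a, subst_at B a 0)"
| "red_fun' r \<Gamma> f' a None = None"

fun red_fun :: "'l solver \<Rightarrow> 'l tm list \<Rightarrow> 'l tm \<Rightarrow> 'l answer \<Rightarrow> 'l answer" where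
  "red_fun r \<Gamma> a (Some (f', F)) = red_fun' r \<Gamma> f' a (as_pi r \<Gamma> F)"
| "red_fun r \<Gamma> a None = None"

text \<open>A saturated eliminator that does not compute continues in its scrutinee, the last
  argument; every other application continues in its function.\<close>

fun red_neutral :: "bool \<Rightarrow> 'l solver \<Rightarrow> 'l tm list \<Rightarrow> 'l tm \<Rightarrow> 'l tm \<Rightarrow> 'l answer" where
  "red_neutral True r \<Gamma> f a = red_arg r \<Gamma> f a (r \<Gamma> (Red a))"
| "red_neutral False r \<Gamma> f a = red_fun r \<Gamma> a (r \<Gamma> (Red f))"

fun red_spine :: "'l tm option \<Rightarrow> 'l solver \<Rightarrow> 'l tm list \<Rightarrow> 'l tm \<Rightarrow> 'l tm \<Rightarrow> 'l answer" where
  "red_spine (Some t) r \<Gamma> f a = retype r \<Gamma> t (r \<Gamma> (Infer (App f a)))"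
| "red_spine None r \<Gamma> f a = red_neutral (elim_spine (spine f [])) r \<Gamma> f a"

fun red_app :: "'l solver \<Rightarrow> 'l tm list \<Rightarrow> 'l tm \<Rightarrow> 'l tm \<Rightarrow> 'l answer" where
  "red_app r \<Gamma> (Lam A b) a = beta b a (sort_of r \<Gamma> A) (r (A # \<Gamma>) (Infer b)) (check r \<Gamma> a A)"
| "red_app r \<Gamma> (App f b) a = red_spine (iota (spine f [b, a])) r \<Gamma> (App f b) a"
| "red_app r \<Gamma> f a = None"

fun red :: "'l solver \<Rightarrow> 'l tm list \<Rightarrow> 'l tm \<Rightarrow> 'l answer" where
  "red r \<Gamma> (App f a) = red_app r \<Gamma> f a"
| "red r \<Gamma> t = None"

section \<open>Judgemental equality\<close>

fun eqv_arg' :: "'l solver \<Rightarrow> 'l tm list \<Rightarrow> 'l tm \<Rightarrow> 'l tm \<Rightarrow> 'l tm \<Rightarrow> 'l answer \<Rightarrow> 'l tm option" where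
  "eqv_arg' r \<Gamma> A B a (Some (b, A')) = guard (conv r \<Gamma> A' A) (subst_at B a 0)"
| "eqv_arg' r \<Gamma> A B a None = None"

fun eqv_arg ::
  "'l solver \<Rightarrow> 'l tm list \<Rightarrow> 'l tm \<Rightarrow> 'l tm \<Rightarrow> ('l tm \<times> 'l tm) option \<Rightarrow> 'l tm option" where
  "eqv_arg r \<Gamma> a b (Some (A, B)) = eqv_arg' r \<Gamma> A B a (r \<Gamma> (Eqv a b))"
| "eqv_arg r \<Gamma> a b None = None"

fun eqv_app :: "'l solver \<Rightarrow> 'l tm list \<Rightarrow> 'l tm \<Rightarrow> 'l tm \<Rightarrow> 'l tm option" where
  "eqv_app r \<Gamma> (App f a) (App g b) = eqv_arg r \<Gamma> a b (answer_as_pi r \<Gamma> (r \<Gamma> (Eqv f g)))"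
| "eqv_app r \<Gamma> s t = None"

fun eqv_at :: "'l solver \<Rightarrow> 'l tm list \<Rightarrow> 'l tm \<Rightarrow> 'l answer \<Rightarrow> 'l tm option" where
  "eqv_at r \<Gamma> T (Some (t, T')) = guard (conv r \<Gamma> T' T) T"
| "eqv_at r \<Gamma> T None = None"

text \<open>The reduction of the right side is typed at \<open>T'\<close>, the remaining comparison
  at \<open>T\<close>. The conversion goes from \<open>T'\<close> to \<open>T\<close> because the
  answer has to be a type of the left side.\<close>

fun eqv_from :: "'l solver \<Rightarrow> 'l tm list \<Rightarrow> 'l tm \<Rightarrow> 'l answer \<Rightarrow> 'l tm option" where
  "eqv_from r \<Gamma> T' (Some (t, T)) = guard (conv r \<Gamma> T' T) T"
| "eqv_from r \<Gamma> T' None = None"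

fun eqv_right :: "'l answer \<Rightarrow> 'l solver \<Rightarrow> 'l tm list \<Rightarrow> 'l tm \<Rightarrow> 'l tm \<Rightarrow> 'l tm option" where
  "eqv_right (Some (t', T')) r \<Gamma> s t = eqv_from r \<Gamma> T' (r \<Gamma> (Eqv s t'))"
| "eqv_right None r \<Gamma> s t = eqv_app r \<Gamma> s t"

fun eqv_left :: "'l answer \<Rightarrow> 'l solver \<Rightarrow> 'l tm list \<Rightarrow> 'l tm \<Rightarrow> 'l tm \<Rightarrow> 'l tm option" where
  "eqv_left (Some (s', T)) r \<Gamma> s t = eqv_at r \<Gamma> T (r \<Gamma> (Eqv s' t))"
| "eqv_left None r \<Gamma> s t = eqv_right (r \<Gamma> (Red t)) r \<Gamma> s t"

fun eqv :: "'l::universe_level solver \<Rightarrow> 'l tm list \<Rightarrow> 'l tm \<Rightarrow> 'l tm \<Rightarrow> 'l tm option" where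
  "eqv r \<Gamma> (Pi A B) (Pi A' B') = pi_sort (eq_sort r \<Gamma> A A') (eq_sort r (A # \<Gamma>) B B')"
| "eqv r \<Gamma> (Lam A b) (Lam A' b') = lam_type A (eq_sort r \<Gamma> A A') (r (A # \<Gamma>) (Eqv b b'))"
| "eqv r \<Gamma> s t = eqv_left (r \<Gamma> (Red s)) r \<Gamma> s t"

fun eqv_unless ::
  "bool \<Rightarrow> 'l::universe_level solver \<Rightarrow> 'l tm list \<Rightarrow> 'l tm \<Rightarrow> 'l tm \<Rightarrow> 'l tm option" where
  "eqv_unless True r \<Gamma> s t = infer r \<Gamma> s"
| "eqv_unless False r \<Gamma> s t = eqv r \<Gamma> s t"

fun with_term :: "'l tm \<Rightarrow> 'l tm option \<Rightarrow> 'l answer" where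
  "with_term t (Some T) = Some (t, T)"
| "with_term t None = None"

fun whd_again :: "'l tm \<Rightarrow> 'l answer \<Rightarrow> 'l answer" where
  "whd_again T (Some (t, T')) = guard (T' = T) (t, T)"
| "whd_again T None = None"

fun whd :: "'l solver \<Rightarrow> 'l tm list \<Rightarrow> 'l answer \<Rightarrow> 'l answer" where
  "whd r \<Gamma> (Some (App f a, T)) = whd_again T (r \<Gamma> (Whd (App f a)))"
| "whd r \<Gamma> x = x"

primrec step :: "'l::universe_level solver \<Rightarrow> 'l solver" where
  "step r \<Gamma> (Infer t) = with_term t (infer r \<Gamma> t)"
| "step r \<Gamma> (Red t) = red r \<Gamma> t"
| "step r \<Gamma> (Whd t) = whd r \<Gamma> (r \<Gamma> (Red t))"
| "step r \<Gamma> (Eqv s t) = with_term t (eqv_unless (s = t) r \<Gamma> s t)"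

text \<open>Fuel ties the recursion. When it is exhausted the answer is \<open>None\<close>, which
  claims nothing, so soundness holds for every amount.\<close>

primrec run :: "nat \<Rightarrow> 'l::universe_level solver" where
  "run 0 \<Gamma> q = None"
| "run (Suc n) \<Gamma> q = step (run n) \<Gamma> q"

section \<open>Soundness of the checker\<close>

text \<open>Reflexivity \<open>A \<doteq> A\<close> needs a derivation that \<open>A\<close> is a
  type, which cannot be read off from a typing at \<open>A\<close> without metatheory; hence the
  separate case of syntactic equality.\<close>

definition ty_eq :: "'l::universe_level tm list \<Rightarrow> 'l tm \<Rightarrow> 'l tm \<Rightarrow> bool" where
  "ty_eq \<Gamma> A B \<longleftrightarrow> A = B \<or> (\<exists>u. \<Gamma> \<turnstile> A \<doteq> B \<^bold>: Univ u)"

lemma ty_eq_refl [simp]: "ty_eq \<Gamma> A A"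
  by (simp add: ty_eq_def)

lemma ty_eq_typing: "ty_eq \<Gamma> A B \<Longrightarrow> \<Gamma> \<turnstile> t \<^bold>: A \<Longrightarrow> \<Gamma> \<turnstile> t \<^bold>: B"
  by (auto simp: ty_eq_def intro: ty_conv)

lemma ty_eq_equality: "ty_eq \<Gamma> A B \<Longrightarrow> \<Gamma> \<turnstile> s \<doteq> t \<^bold>: A \<Longrightarrow> \<Gamma> \<turnstile> s \<doteq> t \<^bold>: B"
  by (auto simp: ty_eq_def intro: eq_conv)

text \<open>Typing is claimed beside equality because \<open>wf_cons\<close>, \<open>eq_pi\<close>
  and \<open>eq_lam\<close> need the domain to be typed. The context is assumed well formed: an
  answer over an extended context is used only together with a sort for the new entry.\<close>

definition valid_answer :: "'l::universe_level tm list \<Rightarrow> 'l tm \<Rightarrow> 'l answer \<Rightarrow> bool" where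
  "valid_answer \<Gamma> s x \<longleftrightarrow> (\<forall>t T. x = Some (t, T) \<longrightarrow> \<turnstile> \<Gamma> \<longrightarrow> \<Gamma> \<turnstile> s \<^bold>: T \<and> \<Gamma> \<turnstile> s \<doteq> t \<^bold>: T)"

text \<open>By the second conjunct an equality answer carries the queried right side itself;
  validity alone would relate \<open>s\<close> to some unspecified term.\<close>

definition sound :: "'l::universe_level solver \<Rightarrow> bool" where
  "sound r \<longleftrightarrow> (\<forall>\<Gamma> q. valid_answer \<Gamma> (subject q) (r \<Gamma> q)) \<and>
     (\<forall>\<Gamma> s t t' T. r \<Gamma> (Eqv s t) = Some (t', T) \<longrightarrow> t' = t)"

context
  fixes r :: "'l::universe_level solver"
  assumes r: "sound r"
begin

lemma r_valid: "r \<Gamma> q = Some (t, T) \<Longrightarrow> \<turnstile> \<Gamma> \<Longrightarrow> \<Gamma> \<turnstile> subject q \<^bold>: T \<and> \<Gamma> \<turnstile> subject q \<doteq> t \<^bold>: T"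
  using r by (simp add: sound_def valid_answer_def)

lemma r_infer: "r \<Gamma> (Infer s) = Some (t, T) \<Longrightarrow> \<turnstile> \<Gamma> \<Longrightarrow> \<Gamma> \<turnstile> s \<^bold>: T"
  using r_valid[of \<Gamma> "Infer s"] by simp

lemma r_red:
  assumes "r \<Gamma> (Red s) = Some (t, T)" "\<turnstile> \<Gamma>"
  shows "\<Gamma> \<turnstile> s \<^bold>: T" "\<Gamma> \<turnstile> s \<doteq> t \<^bold>: T"
  using r_valid[OF assms] by simp_all

lemma r_whd: "r \<Gamma> (Whd s) = Some (t, T) \<Longrightarrow> \<turnstile> \<Gamma> \<Longrightarrow> \<Gamma> \<turnstile> s \<doteq> t \<^bold>: T"
  using r_valid[of \<Gamma> "Whd s"] by simp

lemma r_eqv: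
  assumes "r \<Gamma> (Eqv s t) = Some (t', T)" "\<turnstile> \<Gamma>"
  shows "\<Gamma> \<turnstile> s \<^bold>: T" "\<Gamma> \<turnstile> s \<doteq> t \<^bold>: T"
proof -
  have "t' = t"
    using r assms(1) unfolding sound_def by blast
  then show "\<Gamma> \<turnstile> s \<^bold>: T" "\<Gamma> \<turnstile> s \<doteq> t \<^bold>: T"
    using r_valid[OF assms] by simp_all
qed

lemma answer_univ_SomeD: "answer_univ x = Some u \<Longrightarrow> \<exists>v. x = Some (Univ u, Univ v)"
  by (induction x rule: answer_univ.induct) auto

lemma answer_pi_SomeD: "answer_pi x = Some (A, B) \<Longrightarrow> \<exists>v. x = Some (Pi A B, Univ v)"
  by (induction x rule: answer_pi.induct) auto

lemma as_univ_sound: "as_univ r \<Gamma> T = Some u \<Longrightarrow> \<turnstile> \<Gamma> \<Longrightarrow> ty_eq \<Gamma> T (Univ u)"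
  by (cases T) (auto simp: ty_eq_def dest!: answer_univ_SomeD r_whd)

lemma as_pi_sound: "as_pi r \<Gamma> T = Some (A, B) \<Longrightarrow> \<turnstile> \<Gamma> \<Longrightarrow> ty_eq \<Gamma> T (Pi A B)"
  by (cases T) (auto simp: ty_eq_def dest!: answer_pi_SomeD r_whd)

lemma univ_of_SomeD: "univ_of r \<Gamma> x = Some u \<Longrightarrow> \<exists>t S. x = Some (t, S) \<and> as_univ r \<Gamma> S = Some u"
  by (cases "(r, \<Gamma>, x)" rule: univ_of.cases) auto

lemma sort_of_sound: "sort_of r \<Gamma> A = Some u \<Longrightarrow> \<turnstile> \<Gamma> \<Longrightarrow> \<Gamma> \<turnstile> A \<^bold>: Univ u"
  by (auto simp: sort_of_def dest!: univ_of_SomeD r_infer as_univ_sound dest: ty_eq_typing)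

lemma eq_sort_sound:
  assumes "eq_sort r \<Gamma> A B = Some u" "\<turnstile> \<Gamma>"
  shows "\<Gamma> \<turnstile> A \<^bold>: Univ u" "\<Gamma> \<turnstile> A \<doteq> B \<^bold>: Univ u"
proof -
  obtain t S where *: "r \<Gamma> (Eqv A B) = Some (t, S)" "as_univ r \<Gamma> S = Some u"
    using assms(1) by (auto simp: eq_sort_def dest: univ_of_SomeD)
  note S = as_univ_sound[OF *(2) assms(2)]
  show "\<Gamma> \<turnstile> A \<^bold>: Univ u" "\<Gamma> \<turnstile> A \<doteq> B \<^bold>: Univ u"
    using ty_eq_typing[OF S] ty_eq_equality[OF S] r_eqv[OF *(1) assms(2)] by auto
qed

lemma conv_sound: "conv r \<Gamma> A B \<Longrightarrow> \<turnstile> \<Gamma> \<Longrightarrow> ty_eq \<Gamma> A B"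
  by (cases "A = B") (auto simp: conv_def ty_eq_def Option.is_none_def dest: eq_sort_sound(2))

lemma check_sound: "check r \<Gamma> t A \<Longrightarrow> \<turnstile> \<Gamma> \<Longrightarrow> \<Gamma> \<turnstile> t \<^bold>: A"
  by (cases "r \<Gamma> (Infer t)") (auto simp: check_def dest!: r_infer conv_sound intro: ty_eq_typing)

text \<open>The accumulator starts at \<open>Suc 0\<close> in \<open>infer\<close>, which yields the
  \<open>Suc i\<close> lifts of rule \<open>ty_var\<close>.\<close>

lemma lookup_eq: "lookup \<Gamma> i j = Some A \<Longrightarrow> i < length \<Gamma> \<and> A = lift_by (i + j) (\<Gamma> ! i) 0"
  by (induction \<Gamma> i j rule: lookup.induct) auto

lemma pi_sort_SomeD: "pi_sort x y = Some T \<Longrightarrow> \<exists>u v. x = Some u \<and> y = Some v \<and> T = Univ (u \<squnion> v)"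
  by (cases "(x, y)" rule: pi_sort.cases) auto

lemma lam_type_SomeD:
  "lam_type A x y = Some T \<Longrightarrow> \<exists>u t B. x = Some u \<and> y = Some (t, B) \<and> T = Pi A B"
  by (cases "(A, x, y)" rule: lam_type.cases) auto

lemma answer_as_pi_SomeD:
  "answer_as_pi r \<Gamma> x = Some (A, B) \<Longrightarrow> \<exists>t F. x = Some (t, F) \<and> as_pi r \<Gamma> F = Some (A, B)"
  by (cases x) auto

lemma infer_app_eq: "infer_app r \<Gamma> a x = app_type r \<Gamma> a (answer_as_pi r \<Gamma> x)"
  by (cases "(r, \<Gamma>, a, x)" rule: infer_app.cases) auto

lemma infer_sound:
  assumes "infer r \<Gamma> t = Some T" "\<turnstile> \<Gamma>"
  shows "\<Gamma> \<turnstile> t \<^bold>: T"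
proof (cases t)
  case (Var i)
  then show ?thesis
    using assms ty_var[of \<Gamma> i, unfolded funpow_lift] by (auto dest!: lookup_eq)
next
  case (Pi A B)
  then obtain u v where "sort_of r \<Gamma> A = Some u" "sort_of r (A # \<Gamma>) B = Some v" "T = Univ (u \<squnion> v)"
    using assms(1) by (auto dest!: pi_sort_SomeD)
  then show ?thesis
    using Pi assms(2) by (metis sort_of_sound wf_cons ty_pi)
next
  case (Lam A b)
  then obtain u t' B where "sort_of r \<Gamma> A = Some u" "r (A # \<Gamma>) (Infer b) = Some (t', B)" "T = Pi A B"
    using assms(1) by (auto dest!: lam_type_SomeD)
  then show ?thesis
    using Lam assms(2) by (metis sort_of_sound r_infer wf_cons ty_lam)
next
  case (App f a)
  then obtain A B where *: "answer_as_pi r \<Gamma> (r \<Gamma> (Infer f)) = Some (A, B)" "check r \<Gamma> a A" "T = subst B a 0"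
    using assms(1)
    by (cases "answer_as_pi r \<Gamma> (r \<Gamma> (Infer f))") (auto simp: infer_app_eq subst_at_0)
  then show ?thesis
    using App assms(2)
    by (auto dest!: answer_as_pi_SomeD r_infer as_pi_sound check_sound intro!: ty_app intro: ty_eq_typing)
qed (use assms in \<open>auto intro: ty_univ ty_const\<close>)

lemma beta_SomeD:
  "beta b a x y p = Some z \<Longrightarrow>
     \<exists>u t B. x = Some u \<and> y = Some (t, B) \<and> p \<and> z = (subst b a 0, subst B a 0)"
  by (cases "(b, a, x, y, p)" rule: beta.cases) (auto simp: subst_at_0)

lemma red_sound: "valid_answer \<Gamma> s (red r \<Gamma> s)"
proof -
  have "\<Gamma> \<turnstile> s \<^bold>: T \<and> \<Gamma> \<turnstile> s \<doteq> t \<^bold>: T" if red: "red r \<Gamma> s = Some (t, T)" and wf: "\<turnstile> \<Gamma>" for t T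
  proof -
    obtain f a where s: "s = App f a" and red: "red_app r \<Gamma> f a = Some (t, T)"
      using red by (cases s) auto
    consider (lam) A b where "f = Lam A b"
      | (app) "red_spine (iota (spine s [])) r \<Gamma> f a = Some (t, T)"
      using red s by (cases f) auto
    then show ?thesis
    proof cases
      case lam
      then obtain u t' B where "sort_of r \<Gamma> A = Some u" "r (A # \<Gamma>) (Infer b) = Some (t', B)"
        "check r \<Gamma> a A" "t = subst b a 0" "T = subst B a 0"
        using red by (auto dest!: beta_SomeD)
      then show ?thesis
        using s lam wf by (metis sort_of_sound r_infer check_sound wf_cons ty_lam ty_app eq_beta)
    next
      case app
      show ?thesis
      proof (cases "iota (spine s [])")
        case (Some t')
        then obtain s' where "t = t'" "r \<Gamma> (Infer s) = Some (s', T)" "check r \<Gamma> t T"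
          using app s by (cases "r \<Gamma> (Infer s)") auto
        then show ?thesis
          using Some wf by (auto intro: eq_comp dest: r_infer check_sound iota_comp)
      next
        case None
        show ?thesis
        proof (cases "elim_spine (spine f [])")
          case True
          obtain a' A' A B where "r \<Gamma> (Red a) = Some (a', A')"
            "answer_as_pi r \<Gamma> (r \<Gamma> (Infer f)) = Some (A, B)" "conv r \<Gamma> A' A"
            "t = App f a'" "T = subst B a 0"
            using app None True
            by (cases "r \<Gamma> (Red a)"; cases "answer_as_pi r \<Gamma> (r \<Gamma> (Infer f))") (auto simp: subst_at_0)
          note * = this
          have "\<Gamma> \<turnstile> f \<^bold>: Pi A B"
            using *(2) wf by (auto dest!: answer_as_pi_SomeD r_infer as_pi_sound intro: ty_eq_typing)
          moreover have "\<Gamma> \<turnstile> a \<^bold>: A" "\<Gamma> \<turnstile> a \<doteq> a' \<^bold>: A"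
            using conv_sound[OF *(3) wf] r_red[OF *(1) wf] by (blast intro: ty_eq_typing ty_eq_equality)+
          \<comment> \<open>The type keeps the unreduced argument \<open>a\<close>, exactly as in
            \<open>eq_app\<close>.\<close>
          ultimately show ?thesis
            using s *(4,5) by (auto intro: ty_app eq_app eq_refl)
        next
          case False
          obtain f' F A B where "r \<Gamma> (Red f) = Some (f', F)" "as_pi r \<Gamma> F = Some (A, B)"
            "check r \<Gamma> a A" "t = App f' a" "T = subst B a 0"
          proof (cases "r \<Gamma> (Red f)")
            case (Some fF)
            then show thesis
              using app None False that by (cases fF; cases "as_pi r \<Gamma> (snd fF)") (auto simp: subst_at_0)
          qed (use app None False in auto)
          note * = this
          have "\<Gamma> \<turnstile> f \<^bold>: Pi A B" "\<Gamma> \<turnstile> f \<doteq> f' \<^bold>: Pi A B"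
            using as_pi_sound[OF *(2) wf] r_red[OF *(1) wf] by (blast intro: ty_eq_typing ty_eq_equality)+
          then show ?thesis
            using s *(4,5) check_sound[OF *(3) wf] by (auto intro: ty_app eq_app eq_refl)
        qed
      qed
    qed
  qed
  then show ?thesis
    by (simp add: valid_answer_def)
qed

lemma eqv_app_sound:
  assumes "eqv_app r \<Gamma> s t = Some T" "\<turnstile> \<Gamma>"
  shows "\<Gamma> \<turnstile> s \<^bold>: T \<and> \<Gamma> \<turnstile> s \<doteq> t \<^bold>: T"
proof -
  obtain f a g b A B where *: "s = App f a" "t = App g b" "answer_as_pi r \<Gamma> (r \<Gamma> (Eqv f g)) = Some (A, B)"
    and arg: "eqv_arg' r \<Gamma> A B a (r \<Gamma> (Eqv a b)) = Some T"
  proof (cases "(r, \<Gamma>, s, t)" rule: eqv_app.cases)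
    case (1 r' \<Gamma>' f a g b)
    then show thesis
      using assms(1) that by (cases "answer_as_pi r \<Gamma> (r \<Gamma> (Eqv f g))") auto
  qed (use assms(1) in auto)
  obtain F t' where f: "r \<Gamma> (Eqv f g) = Some (t', F)" "as_pi r \<Gamma> F = Some (A, B)"
    using *(3) by (auto dest: answer_as_pi_SomeD)
  obtain A' t'' where a: "r \<Gamma> (Eqv a b) = Some (t'', A')" "conv r \<Gamma> A' A" "T = subst B a 0"
    using arg by (cases "r \<Gamma> (Eqv a b)") (auto simp: subst_at_0)
  have "\<Gamma> \<turnstile> f \<^bold>: Pi A B" "\<Gamma> \<turnstile> f \<doteq> g \<^bold>: Pi A B"
    using as_pi_sound[OF f(2) assms(2)] r_eqv[OF f(1) assms(2)]
    by (blast intro: ty_eq_typing ty_eq_equality)+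
  moreover have "\<Gamma> \<turnstile> a \<^bold>: A" "\<Gamma> \<turnstile> a \<doteq> b \<^bold>: A"
    using conv_sound[OF a(2) assms(2)] r_eqv[OF a(1) assms(2)]
    by (blast intro: ty_eq_typing ty_eq_equality)+
  ultimately show ?thesis
    using *(1,2) a(3) by (auto intro: ty_app eq_app)
qed

lemma eqv_left_sound:
  assumes "eqv_left (r \<Gamma> (Red s)) r \<Gamma> s t = Some T" "\<turnstile> \<Gamma>"
  shows "\<Gamma> \<turnstile> s \<^bold>: T \<and> \<Gamma> \<turnstile> s \<doteq> t \<^bold>: T"
proof (cases "r \<Gamma> (Red s)")
  case None
  show ?thesis
  proof (cases "r \<Gamma> (Red t)")
    case None
    then show ?thesis
      using assms \<open>r \<Gamma> (Red s) = None\<close> by (intro eqv_app_sound) auto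
  next
    case (Some tT)
    then obtain t' T' t'' where *: "r \<Gamma> (Red t) = Some (t', T')" "r \<Gamma> (Eqv s t') = Some (t'', T)"
      "conv r \<Gamma> T' T"
      using assms(1) None by (cases tT; cases "r \<Gamma> (Eqv s (fst tT))") auto
    show ?thesis
      using r_eqv[OF *(2) assms(2)]
        ty_eq_equality[OF conv_sound[OF *(3) assms(2)] r_red(2)[OF *(1) assms(2)]]
      by (auto intro: eq_trans eq_sym)
  qed
next
  case (Some sT)
  then obtain s' t'' T' where *: "r \<Gamma> (Red s) = Some (s', T)" "r \<Gamma> (Eqv s' t) = Some (t'', T')"
    "conv r \<Gamma> T' T"
    using assms(1) by (cases sT; cases "r \<Gamma> (Eqv (fst sT) t)") auto
  show ?thesis
    using r_red[OF *(1) assms(2)]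
      ty_eq_equality[OF conv_sound[OF *(3) assms(2)]] r_eqv[OF *(2) assms(2)]
    by (blast intro: eq_trans)
qed

lemma eqv_sound:
  assumes "eqv r \<Gamma> s t = Some T" "\<turnstile> \<Gamma>"
  shows "\<Gamma> \<turnstile> s \<^bold>: T \<and> \<Gamma> \<turnstile> s \<doteq> t \<^bold>: T"
proof -
  consider (Pi) A B A' B' where "s = Pi A B" "t = Pi A' B'"
    | (Lam) A b A' b' where "s = Lam A b" "t = Lam A' b'"
    | "eqv r \<Gamma> s t = eqv_left (r \<Gamma> (Red s)) r \<Gamma> s t"
    by (cases s; cases t) auto
  then show ?thesis
  proof cases
    case Pi
    then obtain u v where "T = Univ (u \<squnion> v)" "eq_sort r \<Gamma> A A' = Some u" "eq_sort r (A # \<Gamma>) B B' = Some v"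
      using assms(1) by (auto dest!: pi_sort_SomeD)
    then show ?thesis
      using Pi assms(2) by (metis eq_sort_sound wf_cons ty_pi eq_pi)
  next
    case Lam
    then obtain u B t' where "T = Pi A B" "eq_sort r \<Gamma> A A' = Some u" "r (A # \<Gamma>) (Eqv b b') = Some (t', B)"
      using assms(1) by (auto dest!: lam_type_SomeD)
    then show ?thesis
      using Lam assms(2) by (metis eq_sort_sound r_eqv wf_cons ty_lam eq_lam)
  qed (use assms eqv_left_sound in auto)
qed

lemma with_term_SomeD: "with_term t x = Some (t', T) \<Longrightarrow> t' = t \<and> x = Some T"
  by (cases x) auto

lemma whd_sound: "valid_answer \<Gamma> s (whd r \<Gamma> (r \<Gamma> (Red s)))"
proof -
  have "\<Gamma> \<turnstile> s \<^bold>: T \<and> \<Gamma> \<turnstile> s \<doteq> t \<^bold>: T"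
    if whd: "whd r \<Gamma> (r \<Gamma> (Red s)) = Some (t, T)" and wf: "\<turnstile> \<Gamma>" for t T
  proof -
    obtain t' T' where red: "r \<Gamma> (Red s) = Some (t', T')"
      using whd by (cases "r \<Gamma> (Red s)") auto
    have "T' = T \<and> (t' = t \<or> r \<Gamma> (Whd t') = Some (t, T))"
    proof (cases t')
      case (App f a)
      then show ?thesis
        using whd red by (cases "r \<Gamma> (Whd t')") auto
    qed (use whd red in auto)
    then show ?thesis
      using r_red[OF _ wf] r_whd[OF _ wf] red by (metis eq_trans)
  qed
  then show ?thesis
    by (simp add: valid_answer_def)
qed

lemma step_sound: "sound (step r)"
  unfolding sound_def
proof (intro conjI allI impI)
  fix \<Gamma> q
  show "valid_answer \<Gamma> (subject q) (step r \<Gamma> q)"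
  proof (cases q)
    case (Infer t)
    then show ?thesis
      by (auto simp: valid_answer_def dest!: with_term_SomeD infer_sound intro: eq_refl)
  next
    case (Eqv s t)
    then show ?thesis
      by (cases "s = t") (auto simp: valid_answer_def dest!: with_term_SomeD eqv_sound infer_sound intro: eq_refl)
  qed (use red_sound whd_sound in auto)
qed (auto dest: with_term_SomeD)

end

lemma run_sound: "sound (run n)"
proof (induction n)
  case 0
  then show ?case by (simp add: sound_def valid_answer_def)
next
  case (Suc n)
  show ?case
    using step_sound[OF Suc] by (simp add: sound_def)
qed

lemma holds_if_check: "check (run n) [] (t 0) (A 0) \<Longrightarrow> holds A"
  using check_sound[OF run_sound] wf_nil unfolding holds_def by blast

text \<open>The arrow places its codomain below one binder and \<open>ty_app\<close> substitutes
  into it. A depth-indexed term is an arbitrary function of the depth, so closedness of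
  \<open>B\<close> is a hypothesis; it is discharged by evaluating the substitution.\<close>

lemma holds_mp:
  assumes "holds (A \<rightarrow> B)" "holds A" "\<And>t. subst (B (Suc 0)) t 0 = B 0"
  shows "holds B"
proof -
  obtain f a where f: "[] \<turnstile> f \<^bold>: Pi (A 0) (B (Suc 0))" and a: "[] \<turnstile> a \<^bold>: A 0"
    using assms(1,2) by (auto simp: holds_def arrow_def pi_def)
  show ?thesis
    using ty_app[OF f a] assms(3) by (auto simp: holds_def)
qed

section \<open>Homomorphisms of universe levels\<close>

lemma map_tm_lift: "map_tm f (lift t k) = lift (map_tm f t) k"
  by (induction t arbitrary: k) auto

lemma map_tm_subst: "map_tm f (subst t s k) = subst (map_tm f t) (map_tm f s) k"
  by (induction t arbitrary: s k) (auto simp: map_tm_lift)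

lemma map_tm_lift_funpow: "map_tm f (((\<lambda>A. lift A 0) ^^ n) t) = ((\<lambda>A. lift A 0) ^^ n) (map_tm f t)"
  by (induction n) (auto simp: map_tm_lift)

lemma map_tm_apps: "map_tm f (apps t as) = apps (map_tm f t) (map (map_tm f) as)"
  by (induction as arbitrary: t) (auto simp: apps_def)

lemma map_tm_comp: "comp s t \<Longrightarrow> comp (map_tm f s) (map_tm f t)"
  by (induction rule: comp.induct) (auto simp: map_tm_apps intro: comp.intros)

locale level_hom =
  fixes f :: "'a::universe_level \<Rightarrow> 'b::universe_level"
  assumes f_bot: "f \<bottom> = \<bottom>"
    and f_sup: "f (u \<squnion> v) = f u \<squnion> f v"
    and f_usuc: "f (usuc u) = usuc (f u)"
begin

lemma map_tm_cty: "map_tm f (cty c n) = cty (map_const f c) n"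
  by (cases c) (simp_all add: pi_def lam_def app_def univ_def con_def arrow_def eqt_def is_prop_def
      bound_def f_bot f_sup f_usuc)

text \<open>The rules mention levels only through \<bottom>, \<squnion> and \<open>usuc\<close>, so
  the image of each rule instance is again an instance.\<close>

lemma derivation_map:
  shows "\<turnstile> \<Gamma> \<Longrightarrow> \<turnstile> map (map_tm f) \<Gamma>"
    and "\<Gamma> \<turnstile> t \<^bold>: A \<Longrightarrow> map (map_tm f) \<Gamma> \<turnstile> map_tm f t \<^bold>: map_tm f A"
    and "\<Gamma> \<turnstile> s \<doteq> t \<^bold>: A \<Longrightarrow> map (map_tm f) \<Gamma> \<turnstile> map_tm f s \<doteq> map_tm f t \<^bold>: map_tm f A"
proof (induction rule: wf_ctx_typing_equality.inducts)
  case (ty_var \<Gamma> i)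
  then show ?case
    using Defs.ty_var[of "map (map_tm f) \<Gamma>" i] by (simp add: map_tm_lift map_tm_lift_funpow)
qed (auto simp: f_sup f_usuc map_tm_cty map_tm_subst map_tm_lift
    intro: wf_ctx_typing_equality.intros map_tm_comp)

end

text \<open>
  \<open>Lev n a b\<close> stands for \<open>(usuc ^^ n) \<bottom> \<squnion> (usuc ^^ (a - 1)) u \<squnion> (usuc ^^ (b - 1)) v\<close> for two
  generators \<open>u\<close> and \<open>v\<close>, where a generator with coefficient \<open>0\<close> is absent.
\<close>

datatype lev = Lev (lev0: nat) (lev1: nat) (lev2: nat)

instantiation lev :: universe_level
begin

definition less_eq_lev :: "lev \<Rightarrow> lev \<Rightarrow> bool" where
  "u \<le> v \<longleftrightarrow> lev0 u \<le> lev0 v \<and> lev1 u \<le> lev1 v \<and> lev2 u \<le> lev2 v"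

definition less_lev :: "lev \<Rightarrow> lev \<Rightarrow> bool" where
  "less_lev u v \<longleftrightarrow> u \<le> v \<and> \<not> v \<le> u"

definition sup_lev :: "lev \<Rightarrow> lev \<Rightarrow> lev" where
  "u \<squnion> v = Lev (max (lev0 u) (lev0 v)) (max (lev1 u) (lev1 v)) (max (lev2 u) (lev2 v))"

definition bot_lev :: lev where
  "\<bottom> = Lev 0 0 0"

definition usuc_lev :: "lev \<Rightarrow> lev" where
  "usuc u = Lev (Suc (lev0 u)) (if lev1 u = 0 then 0 else Suc (lev1 u))
     (if lev2 u = 0 then 0 else Suc (lev2 u))"

instance
  by standard (auto simp: less_eq_lev_def less_lev_def sup_lev_def bot_lev_def usuc_lev_def max_def
      intro: lev.expand)

end

lemma sup_lev_Lev: "Lev a b c \<squnion> Lev a' b' c' = Lev (max a a') (max b b') (max c c')"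
  by (simp add: sup_lev_def)

fun bump :: "nat \<Rightarrow> nat" where
  "bump 0 = 0"
| "bump (Suc n) = Suc (Suc n)"

lemma usuc_lev_Lev: "usuc (Lev a b c) = Lev (Suc a) (bump b) (bump c)"
  by (cases b; cases c) (simp_all add: usuc_lev_def)

text \<open>Coefficient \<open>Suc 0\<close> stands for zero successors, so
  \<open>interp u v\<close> sends these to \<open>u\<close> and \<open>v\<close>.\<close>

abbreviation "gen_u \<equiv> Lev 0 (Suc 0) 0"
abbreviation "gen_v \<equiv> Lev 0 0 (Suc 0)"

section \<open>Interpretation of the formal levels\<close>

definition iter :: "nat \<Rightarrow> 'l::universe_level \<Rightarrow> 'l" where
  "iter a u = (case a of 0 \<Rightarrow> \<bottom> | Suc k \<Rightarrow> (usuc ^^ k) u)"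

primrec interp :: "'l::universe_level \<Rightarrow> 'l \<Rightarrow> lev \<Rightarrow> 'l" where
  "interp u v (Lev n a b) = (usuc ^^ n) \<bottom> \<squnion> iter a u \<squnion> iter b v"

lemma funpow_usuc_mono: "m \<le> n \<Longrightarrow> (usuc ^^ m) u \<le> (usuc ^^ n) (u :: 'l::universe_level)"
  by (rule lift_Suc_mono_le[where f = "\<lambda>n. (usuc ^^ n) u"]) (simp_all add: less_usuc less_imp_le)

lemma funpow_usuc_max: "(usuc ^^ max m n) u = (usuc ^^ m) u \<squnion> (usuc ^^ n) (u :: 'l::universe_level)"
  by (cases "m \<le> n") (auto simp: max_def sup.absorb1 sup.absorb2 funpow_usuc_mono)

lemma iter_max: "iter (max a b) u = iter a u \<squnion> iter b u"
  by (cases a; cases b) (auto simp: iter_def funpow_usuc_max)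

text \<open>A map that distributes over \<squnion> is monotone. Therefore \<open>usuc\<close> on
  \<open>lev\<close> may raise the constant part even when a generator is present.\<close>

lemma usuc_bot_le: "usuc \<bottom> \<le> usuc (u :: 'l::universe_level)"
  by (metis sup.absorb_iff2 sup_bot_left usuc_sup)

text \<open>An absent generator stays absent under \<open>usuc\<close>, although the successor of
  its value \<bottom> is not \<bottom>; the summand \<open>usuc \<bottom>\<close> makes up for the
  difference.\<close>

lemma usuc_iter:
  "usuc \<bottom> \<squnion> usuc (iter a u) = usuc \<bottom> \<squnion> iter (if a = 0 then 0 else Suc a) u"
  by (cases a) (auto simp: iter_def)

lemma level_hom_interp: "level_hom (interp u v)"
proof
  show "interp u v \<bottom> = \<bottom>"
    by (simp add: bot_lev_def iter_def)
  show "interp u v (x \<squnion> y) = interp u v x \<squnion> interp u v y" for x y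
    by (cases x; cases y) (simp add: sup_lev_def funpow_usuc_max iter_max ac_simps)
  show "interp u v (usuc x) = usuc (interp u v x)" for x
  proof (cases x)
    case (Lev n a b)
    let ?a = "if a = 0 then 0 else Suc a" and ?b = "if b = 0 then 0 else Suc b"
    have absorb: "usuc \<bottom> \<squnion> usuc z = usuc z" for z :: 'a
      by (simp add: sup.absorb2 usuc_bot_le)
    then have absorb': "usuc \<bottom> \<squnion> (usuc z \<squnion> y) = usuc z \<squnion> y" for y z :: 'a
      by (metis sup.assoc)
    \<comment> \<open>A copy of \<open>usuc \<bottom>\<close> is inserted beside each generator so
      that \<open>usuc_iter\<close> applies; the successor of the constant part absorbs the copies
      afterwards.\<close>
    have "usuc (interp u v x) =
        usuc ((usuc ^^ n) \<bottom>) \<squnion> (usuc \<bottom> \<squnion> usuc (iter a u)) \<squnion> (usuc \<bottom> \<squnion> usuc (iter b v))"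
      using Lev by (simp add: usuc_sup absorb)
    also have "\<dots> = usuc ((usuc ^^ n) \<bottom>) \<squnion> iter ?a u \<squnion> iter ?b v"
      unfolding usuc_iter by (simp add: absorb' ac_simps)
    finally show ?thesis
      using Lev by (simp add: usuc_lev_def)
  qed
qed

section \<open>Proof terms\<close>

syntax
  "_lam" :: "pttrn \<Rightarrow> 'l dtm \<Rightarrow> 'l dtm \<Rightarrow> 'l dtm"
    ("(3\<Lambda> _:_./ _)" [0, 61, 10] 10)
translations
  "\<Lambda> x:A. b" \<rightleftharpoons> "CONST lam A (\<lambda>x. b)"

section \<open>Combinators for pairs and paths\<close>

definition pair :: "'l \<Rightarrow> 'l \<Rightarrow> 'l dtm \<Rightarrow> ('l dtm \<Rightarrow> 'l dtm) \<Rightarrow> 'l dtm \<Rightarrow> 'l dtm \<Rightarrow> 'l dtm" where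
  "pair i j A B a b = con (CPair i j) \<cdot> A \<cdot> (\<Lambda> x:A. B x) \<cdot> a \<cdot> b"

definition split ::
  "'l \<Rightarrow> 'l \<Rightarrow> 'l \<Rightarrow> 'l dtm \<Rightarrow> ('l dtm \<Rightarrow> 'l dtm) \<Rightarrow> ('l dtm \<Rightarrow> 'l dtm) \<Rightarrow>
    ('l dtm \<Rightarrow> 'l dtm \<Rightarrow> 'l dtm) \<Rightarrow> 'l dtm \<Rightarrow> 'l dtm" where
  "split i j k A B C d p =
     con (CSigmaInd i j k) \<cdot> A \<cdot> (\<Lambda> x:A. B x) \<cdot> (\<Lambda> p:sigma i j A B. C p) \<cdot>
       (\<Lambda> a:A. \<Lambda> b:B a. d a b) \<cdot> p"

definition proj1 :: "'l \<Rightarrow> 'l \<Rightarrow> 'l dtm \<Rightarrow> ('l dtm \<Rightarrow> 'l dtm) \<Rightarrow> 'l dtm \<Rightarrow> 'l dtm" where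
  "proj1 i j A B p = split i j i A B (\<lambda>_. A) (\<lambda>a _. a) p"

definition prod_snd :: "'l \<Rightarrow> 'l \<Rightarrow> 'l dtm \<Rightarrow> 'l dtm \<Rightarrow> 'l dtm \<Rightarrow> 'l dtm" where
  "prod_snd i j A B p = split i j j A (\<lambda>_. B) (\<lambda>_. B) (\<lambda>_ b. b) p"

definition rfl :: "'l \<Rightarrow> 'l dtm \<Rightarrow> 'l dtm \<Rightarrow> 'l dtm" where
  "rfl i A a = con (CRefl i) \<cdot> A \<cdot> a"

definition path_ind ::
  "'l \<Rightarrow> 'l \<Rightarrow> 'l dtm \<Rightarrow> ('l dtm \<Rightarrow> 'l dtm \<Rightarrow> 'l dtm \<Rightarrow> 'l dtm) \<Rightarrow> ('l dtm \<Rightarrow> 'l dtm) \<Rightarrow>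
    'l dtm \<Rightarrow> 'l dtm \<Rightarrow> 'l dtm \<Rightarrow> 'l dtm" where
  "path_ind i k A C d x y p =
     con (CJ i k) \<cdot> A \<cdot> (\<Lambda> x:A. \<Lambda> y:A. \<Lambda> p:eqt i A x y. C x y p) \<cdot> (\<Lambda> x:A. d x) \<cdot> x \<cdot> y \<cdot> p"

text \<open>The concatenation of the inverse of \<open>p\<close> with \<open>q\<close>, a path from
  \<open>y\<close> to \<open>z\<close>; it reduces to \<open>q\<close> when \<open>p\<close> is
  reflexivity. Precomposing \<open>h x y\<close> with the inverse of \<open>h x x\<close> gives a
  path that is trivial on the diagonal.\<close>

definition cancel :: "'l \<Rightarrow> 'l dtm \<Rightarrow> 'l dtm \<Rightarrow> 'l dtm \<Rightarrow> 'l dtm \<Rightarrow> 'l dtm \<Rightarrow> 'l dtm \<Rightarrow> 'l dtm" where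
  "cancel i A x y z p q =
     path_ind i i A (\<lambda>x y _. \<Pi> z:A. eqt i A x z \<rightarrow> eqt i A y z)
       (\<lambda>x. \<Lambda> z:A. \<Lambda> r:eqt i A x z. r) x y p \<cdot> z \<cdot> q"

section \<open>Propositions, sets and subtypes\<close>

definition prop_is_set :: "'l \<Rightarrow> 'l dtm" where
  "prop_is_set i = (\<Pi> A:univ i. is_prop i A \<rightarrow> (\<Pi> x:A. \<Pi> y:A. is_prop i (eqt i A x y)))"

text \<open>
  Hedberg's argument: a path \<open>p\<close> from \<open>x\<close> to \<open>y\<close> equals the path \<open>K x y\<close>, which does not depend on
  it.
\<close>

definition prop_is_set_proof :: "'l \<Rightarrow> 'l dtm" where
  "prop_is_set_proof i =
     (\<Lambda> A:univ i. \<Lambda> h:is_prop i A. \<Lambda> x:A. \<Lambda> y:A. \<Lambda> p:eqt i A x y. \<Lambda> q:eqt i A x y.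
        let K = \<lambda>x y. cancel i A x x y (h \<cdot> x \<cdot> x) (h \<cdot> x \<cdot> y);
          inv = \<lambda>x y q. path_ind i i A
            (\<lambda>x y q. eqt i (eqt i A y y) (cancel i A x y y q q) (rfl i A y))
            (\<lambda>x. rfl i (eqt i A x x) (rfl i A x)) x y q;
          K_eq = \<lambda>x y p. path_ind i i A (\<lambda>x y p. eqt i (eqt i A x y) (K x y) p)
            (\<lambda>x. inv x x (h \<cdot> x \<cdot> x)) x y p
        in cancel i (eqt i A x y) (K x y) p q (K_eq x y p) (K_eq x y q))"

definition subtype_ext :: "'l::universe_level \<Rightarrow> 'l \<Rightarrow> 'l dtm" where
  "subtype_ext i j =
     (\<Pi> A:univ i. \<Pi> B:(A \<rightarrow> univ j). (\<Pi> a:A. is_prop j (B \<cdot> a)) \<rightarrow>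
       (\<Pi> x:sigma i j A (\<lambda>a. B \<cdot> a). \<Pi> y:sigma i j A (\<lambda>a. B \<cdot> a).
         eqt i A (proj1 i j A (\<lambda>a. B \<cdot> a) x) (proj1 i j A (\<lambda>a. B \<cdot> a) y) \<rightarrow>
         eqt (i \<squnion> j) (sigma i j A (\<lambda>a. B \<cdot> a)) x y))"

text \<open>After both pairs are split, path induction identifies the first components. Its motive
  quantifies over both second components, which thereby come to lie in one fibre \<open>B a\<close>,
  where \<open>h\<close> identifies them.\<close>

definition subtype_ext_proof :: "'l::universe_level \<Rightarrow> 'l \<Rightarrow> 'l dtm" where
  "subtype_ext_proof i j =
     (\<Lambda> A:univ i. \<Lambda> B:(A \<rightarrow> univ j). \<Lambda> h:(\<Pi> a:A. is_prop j (B \<cdot> a)).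
        let B' = \<lambda>a. B \<cdot> a; S = sigma i j A B'; mk = pair i j A B'; p1 = proj1 i j A B'; k = i \<squnion> j
        in \<Lambda> x:S. \<Lambda> y:S.
          split i j k A B' (\<lambda>x. \<Pi> y:S. eqt i A (p1 x) (p1 y) \<rightarrow> eqt k S x y)
            (\<lambda>a b. \<Lambda> y:S. split i j k A B' (\<lambda>y. eqt i A (p1 (mk a b)) (p1 y) \<rightarrow> eqt k S (mk a b) y)
              (\<lambda>a' b'. \<Lambda> e:eqt i A a a'.
                path_ind i k A (\<lambda>a a' _. \<Pi> b:B' a. \<Pi> b':B' a'. eqt k S (mk a b) (mk a' b'))
                  (\<lambda>a. \<Lambda> b:B' a. \<Lambda> b':B' a.
                    path_ind j k (B' a) (\<lambda>b b' _. eqt k S (mk a b) (mk a b'))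
                      (\<lambda>b. rfl k S (mk a b)) b b' (h \<cdot> a \<cdot> b \<cdot> b'))
                  a a' e \<cdot> b \<cdot> b')
              y)
            x \<cdot> y)"

text \<open>An inhabitant of \<open>is_prop\<close> for a product, by function extensionality;
  \<open>h a\<close> witnesses that \<open>B a\<close> is a proposition.\<close>

definition prop_pi :: "'l \<Rightarrow> 'l \<Rightarrow> 'l dtm \<Rightarrow> ('l dtm \<Rightarrow> 'l dtm) \<Rightarrow> ('l dtm \<Rightarrow> 'l dtm) \<Rightarrow> 'l dtm" where
  "prop_pi i j A B h =
     (\<Lambda> f:(\<Pi> a:A. B a). \<Lambda> g:(\<Pi> a:A. B a).
        con (CFunext i j) \<cdot> A \<cdot> (\<Lambda> a:A. B a) \<cdot> f \<cdot> g \<cdot> (\<Lambda> a:A. h a \<cdot> (f \<cdot> a) \<cdot> (g \<cdot> a)))"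

text \<open>The fibre of the forward map over \<open>b\<close> is centred at the image of
  \<open>b\<close> under the backward map. It is a subtype of the proposition \<open>P\<close>,
  because identity types of the proposition \<open>Q\<close> are propositions.\<close>

definition prop_equivalence :: "'l::universe_level \<Rightarrow> 'l \<Rightarrow> 'l dtm" where
  "prop_equivalence i j =
     (\<Pi> P:univ i. \<Pi> Q:univ j. is_prop i P \<rightarrow> is_prop j Q \<rightarrow> (P \<rightarrow> Q) \<rightarrow> (Q \<rightarrow> P) \<rightarrow>
       equivalent i j P Q)"

text \<open>
  \<open>E \<cdot> a\<close> is kept unreduced: the computation rule of \<open>CSigmaInd\<close> applies only if the parameters of
  the eliminator and of the pair coincide syntactically, and \<open>ext\<close> projects from \<open>E \<cdot> a\<close>.
\<close>

definition prop_equivalence_proof :: "'l::universe_level \<Rightarrow> 'l \<Rightarrow> 'l dtm" where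
  "prop_equivalence_proof i j =
     (\<Lambda> is_set:prop_is_set j. \<Lambda> ext:subtype_ext i j.
      \<Lambda> P:univ i. \<Lambda> Q:univ j. \<Lambda> hP:is_prop i P. \<Lambda> hQ:is_prop j Q. \<Lambda> f:(P \<rightarrow> Q). \<Lambda> g:(Q \<rightarrow> P).
        let k = i \<squnion> j in
        pair k k (P \<rightarrow> Q) (\<lambda>f. is_equiv i j P Q f) f
          (\<Lambda> b:Q.
            let E = \<Lambda> a:P. eqt j Q (f \<cdot> a) b; F = fiber i j P Q f b; p1 = proj1 i j P (\<lambda>a. E \<cdot> a);
              c = pair i j P (\<lambda>a. E \<cdot> a) (g \<cdot> b) (hQ \<cdot> (f \<cdot> (g \<cdot> b)) \<cdot> b)
            in pair k k F (\<lambda>c. \<Pi> x:F. eqt k F c x) c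
              (\<Lambda> x:F. ext \<cdot> P \<cdot> E \<cdot> (\<Lambda> a:P. is_set \<cdot> Q \<cdot> hQ \<cdot> (f \<cdot> a) \<cdot> b) \<cdot> c \<cdot> x \<cdot>
                (hP \<cdot> p1 c \<cdot> p1 x))))"

definition unit_prop :: "'l \<Rightarrow> 'l dtm" where
  "unit_prop i = (\<Lambda> x:con (CUnit i).
     con (CUnitInd i i) \<cdot> (\<Lambda> x:con (CUnit i). \<Pi> y:con (CUnit i). eqt i (con (CUnit i)) x y) \<cdot>
       (\<Lambda> y:con (CUnit i). con (CUnitInd i i) \<cdot>
         (\<Lambda> y:con (CUnit i). eqt i (con (CUnit i)) (con (CStar i)) y) \<cdot>
         rfl i (con (CUnit i)) (con (CStar i)) \<cdot> y) \<cdot> x)"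

section \<open>The lattice of small parts\<close>

definition resized :: "'l::universe_level \<Rightarrow> 'l \<Rightarrow> 'l dtm \<Rightarrow> 'l dtm" where
  "resized u v P = (\<Sigma>\<^bsub>usuc v,u \<squnion> v\<^esub> Q:univ v. equivalent u v P Q)"

definition order_of :: "'l dtm \<Rightarrow> 'l dtm \<Rightarrow> 'l dtm" where
  "order_of X car = (\<Lambda> x:X. \<Lambda> y:X. car \<cdot> x \<rightarrow> car \<cdot> y)"

definition poset_proof ::
  "'l::universe_level \<Rightarrow> 'l \<Rightarrow> 'l dtm \<Rightarrow> 'l dtm \<Rightarrow> 'l dtm \<Rightarrow> 'l dtm \<Rightarrow> 'l dtm" where
  "poset_proof w v X car car_prop ext =
     (let le = order_of X car; k = w \<squnion> v; P = prop_valued v X le; R = reflexive X le; T = transitive X le;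
        A = antisymmetric w X le
      in pair k k P (\<lambda>_. prod k k R (prod k k T A))
        (\<Lambda> x:X. \<Lambda> y:X. prop_pi v v (car \<cdot> x) (\<lambda>_. car \<cdot> y) (\<lambda>_. car_prop \<cdot> y))
        (pair k k R (\<lambda>_. prod k k T A)
          (\<Lambda> x:X. \<Lambda> q:car \<cdot> x. q)
          (pair k k T (\<lambda>_. A)
            (\<Lambda> x:X. \<Lambda> y:X. \<Lambda> z:X. \<Lambda> f:(car \<cdot> x \<rightarrow> car \<cdot> y). \<Lambda> g:(car \<cdot> y \<rightarrow> car \<cdot> z).
              \<Lambda> q:car \<cdot> x. g \<cdot> (f \<cdot> q))
            ext)))"

text \<open>The indices and the carriers are in universe \<open>v\<close>, so the truncated sum is
  too and \<open>mk\<close> accepts it. The truncation is eliminated twice: into \<open>P\<close>,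
  for the map of the new part, and into \<open>car \<cdot> y\<close>, for leastness.\<close>

definition sups_proof ::
  "'l::universe_level \<Rightarrow> 'l \<Rightarrow> 'l \<Rightarrow> 'l dtm \<Rightarrow> 'l dtm \<Rightarrow> 'l dtm \<Rightarrow> 'l dtm \<Rightarrow> 'l dtm \<Rightarrow> 'l dtm \<Rightarrow> 'l dtm \<Rightarrow>
    'l dtm \<Rightarrow> 'l dtm \<Rightarrow> 'l dtm" where
  "sups_proof w u v P hP X car car_prop out mk unmk remk =
     (\<Lambda> I:univ v. \<Lambda> \<alpha>:(I \<rightarrow> X).
        let le = order_of X car; C = \<lambda>i. car \<cdot> (\<alpha> \<cdot> i); S = sigma v v I C; Q = con (CTrunc v) \<cdot> S;
          rec = \<lambda>k T hT d. con (CTruncRec v k) \<cdot> S \<cdot> T \<cdot> hT \<cdot>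
            (\<Lambda> z:S. split v v k I C (\<lambda>_. T) d z);
          hQ = con (CTruncProp v) \<cdot> S;
          f = rec u P hP (\<lambda>i q. out \<cdot> (\<alpha> \<cdot> i) \<cdot> q);
          s = mk \<cdot> Q \<cdot> hQ \<cdot> f
        in pair w (v \<squnion> w \<squnion> v) X (\<lambda>s. is_sup v w v X le I \<alpha> s) s
          (pair (v \<squnion> v) (v \<squnion> w \<squnion> v)
            (\<Pi> i:I. le \<cdot> (\<alpha> \<cdot> i) \<cdot> s)
            (\<lambda>_. \<Pi> y:X. (\<Pi> i:I. le \<cdot> (\<alpha> \<cdot> i) \<cdot> y) \<rightarrow> le \<cdot> s \<cdot> y)
            (\<Lambda> i:I. \<Lambda> q:C i. remk \<cdot> Q \<cdot> hQ \<cdot> f \<cdot> (con (CTruncIn v) \<cdot> S \<cdot> pair v v I C i q))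
            (\<Lambda> y:X. \<Lambda> h:(\<Pi> i:I. C i \<rightarrow> car \<cdot> y). \<Lambda> c:car \<cdot> s.
              rec v (car \<cdot> y) (car_prop \<cdot> y) (\<lambda>i q. h \<cdot> i \<cdot> q) \<cdot> (unmk \<cdot> Q \<cdot> hQ \<cdot> f \<cdot> c))))"

text \<open>
  The type of small parts enters only through a carrier map, a constructor and extensionality, so
  that the lattice is built over variables and the terms to be checked stay small.
\<close>

definition small_parts :: "'l::universe_level \<Rightarrow> 'l \<Rightarrow> 'l dtm" where
  "small_parts u v =
     (let w = usuc v \<squnion> u in
      Tarskis_Theorem v w v \<rightarrow>
      (\<Pi> P:univ u. is_prop u P \<rightarrow>
        (\<Pi> X:univ w. \<Pi> car:(X \<rightarrow> univ v).
          (\<Pi> x:X. is_prop v (car \<cdot> x)) \<rightarrow>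
          (\<Pi> x:X. car \<cdot> x \<rightarrow> P) \<rightarrow>
          (\<Pi> mk:(\<Pi> Q:univ v. is_prop v Q \<rightarrow> (Q \<rightarrow> P) \<rightarrow> X).
            (\<Pi> Q:univ v. \<Pi> h:is_prop v Q. \<Pi> f:(Q \<rightarrow> P). car \<cdot> (mk \<cdot> Q \<cdot> h \<cdot> f) \<rightarrow> Q) \<rightarrow>
            (\<Pi> Q:univ v. \<Pi> h:is_prop v Q. \<Pi> f:(Q \<rightarrow> P). Q \<rightarrow> car \<cdot> (mk \<cdot> Q \<cdot> h \<cdot> f)) \<rightarrow>
            (\<Pi> x:X. \<Pi> y:X. (car \<cdot> x \<rightarrow> car \<cdot> y) \<rightarrow> (car \<cdot> y \<rightarrow> car \<cdot> x) \<rightarrow> eqt w X x y) \<rightarrow>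
            resized u v P))))"

text \<open>\<open>E y\<close> reduces to an equation of \<open>y\<close> with itself, so
  \<open>rfl\<close> makes every element a fixed point and the greatest fixed point is a top
  element. The part built from the unit type and the constant map at \<open>p\<close> lies below
  it.\<close>

definition small_parts_proof :: "'l::universe_level \<Rightarrow> 'l \<Rightarrow> 'l dtm" where
  "small_parts_proof u v =
     (let w = usuc v \<squnion> u in
      \<Lambda> equiv:prop_equivalence u v. \<Lambda> tarski:Tarskis_Theorem v w v.
      \<Lambda> P:univ u. \<Lambda> hP:is_prop u P. \<Lambda> X:univ w. \<Lambda> car:(X \<rightarrow> univ v).
      \<Lambda> car_prop:(\<Pi> x:X. is_prop v (car \<cdot> x)).
      \<Lambda> out:(\<Pi> x:X. car \<cdot> x \<rightarrow> P).
      \<Lambda> mk:(\<Pi> Q:univ v. is_prop v Q \<rightarrow> (Q \<rightarrow> P) \<rightarrow> X).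
      \<Lambda> unmk:(\<Pi> Q:univ v. \<Pi> h:is_prop v Q. \<Pi> f:(Q \<rightarrow> P). car \<cdot> (mk \<cdot> Q \<cdot> h \<cdot> f) \<rightarrow> Q).
      \<Lambda> remk:(\<Pi> Q:univ v. \<Pi> h:is_prop v Q. \<Pi> f:(Q \<rightarrow> P). Q \<rightarrow> car \<cdot> (mk \<cdot> Q \<cdot> h \<cdot> f)).
      \<Lambda> ext:(\<Pi> x:X. \<Pi> y:X. (car \<cdot> x \<rightarrow> car \<cdot> y) \<rightarrow> (car \<cdot> y \<rightarrow> car \<cdot> x) \<rightarrow> eqt w X x y).
        let le = order_of X car; id = \<Lambda> x:X. x;
          E = \<lambda>x. eqt w X (id \<cdot> x) x;
          M = \<lambda>x. \<Pi> y:X. E y \<rightarrow> le \<cdot> y \<cdot> x;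
          top = tarski \<cdot> X \<cdot> le \<cdot> poset_proof w v X car car_prop ext \<cdot>
            sups_proof w u v P hP X car car_prop out mk unmk remk \<cdot> id \<cdot>
            (\<Lambda> x:X. \<Lambda> y:X. \<Lambda> f:(car \<cdot> x \<rightarrow> car \<cdot> y). f)
        in split w (w \<squnion> v) (usuc v \<squnion> (u \<squnion> v)) X (\<lambda>x. prod w (w \<squnion> v) (E x) (M x)) (\<lambda>_. resized u v P)
          (\<lambda>x m. pair (usuc v) (u \<squnion> v) (univ v) (\<lambda>Q. equivalent u v P Q) (car \<cdot> x)
            (equiv \<cdot> P \<cdot> (car \<cdot> x) \<cdot> hP \<cdot> (car_prop \<cdot> x) \<cdot>
              (\<Lambda> p:P.
                let one = con (CUnit v); c = \<Lambda> _:one. p; y = mk \<cdot> one \<cdot> unit_prop v \<cdot> c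
                in prod_snd w (w \<squnion> v) (E x) (M x) m \<cdot> y \<cdot> rfl w X y \<cdot>
                  (remk \<cdot> one \<cdot> unit_prop v \<cdot> c \<cdot> con (CStar v))) \<cdot>
              (out \<cdot> x)))
          top)"

text \<open>Since \<open>car\<close> of a constructed part reduces to its proposition,
  \<open>copy\<close> serves as both maps between them. Antisymmetry comes from propositional
  extensionality on carriers, lifted by \<open>ext\<close>; \<open>B_prop\<close> supplies that the
  remaining data are unique.\<close>

definition resizing_proof :: "'l::universe_level \<Rightarrow> 'l \<Rightarrow> 'l dtm" where
  "resizing_proof u v =
     (\<Lambda> is_set:prop_is_set v. \<Lambda> ext:subtype_ext (usuc v) (v \<squnion> u). \<Lambda> ext':subtype_ext v (v \<squnion> u).
      \<Lambda> parts:small_parts u v.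
      \<Lambda> tarski:Tarskis_Theorem v (usuc v \<squnion> u) v. \<Lambda> P:univ u. \<Lambda> hP:is_prop u P.
        let B = \<lambda>Q. prod v (v \<squnion> u) (is_prop v Q) (Q \<rightarrow> P);
          X = sigma (usuc v) (v \<squnion> u) (univ v) B;
          car = \<Lambda> x:X. proj1 (usuc v) (v \<squnion> u) (univ v) B x;
          car_prop = \<Lambda> x:X. split (usuc v) (v \<squnion> u) v (univ v) B (\<lambda>x. is_prop v (car \<cdot> x))
            (\<lambda>Q m. proj1 v (v \<squnion> u) (is_prop v Q) (\<lambda>_. Q \<rightarrow> P) m) x;
          out = \<Lambda> x:X. split (usuc v) (v \<squnion> u) (v \<squnion> u) (univ v) B (\<lambda>x. car \<cdot> x \<rightarrow> P)
            (\<lambda>Q m. prod_snd v (v \<squnion> u) (is_prop v Q) (Q \<rightarrow> P) m) x;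
          mk = \<Lambda> Q:univ v. \<Lambda> h:is_prop v Q. \<Lambda> f:(Q \<rightarrow> P).
            pair (usuc v) (v \<squnion> u) (univ v) B Q (pair v (v \<squnion> u) (is_prop v Q) (\<lambda>_. Q \<rightarrow> P) h f);
          copy = \<Lambda> Q:univ v. \<Lambda> h:is_prop v Q. \<Lambda> f:(Q \<rightarrow> P). \<Lambda> q:Q. q;
          B_prop = \<lambda>Q. \<Lambda> m:B Q. \<Lambda> m':B Q.
            let p1 = proj1 v (v \<squnion> u) (is_prop v Q) (\<lambda>_. Q \<rightarrow> P)
            in ext' \<cdot> is_prop v Q \<cdot> (\<Lambda> _:is_prop v Q. Q \<rightarrow> P) \<cdot>
              (\<Lambda> _:is_prop v Q. prop_pi v u Q (\<lambda>_. P) (\<lambda>_. hP)) \<cdot> m \<cdot> m' \<cdot>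
              (prop_pi v v Q (\<lambda>x. \<Pi> y:Q. eqt v Q x y)
                (\<lambda>x. prop_pi v v Q (\<lambda>y. eqt v Q x y) (\<lambda>y. is_set \<cdot> Q \<cdot> p1 m \<cdot> x \<cdot> y)) \<cdot> p1 m \<cdot> p1 m')
        in parts \<cdot> tarski \<cdot> P \<cdot> hP \<cdot> X \<cdot> car \<cdot> car_prop \<cdot> out \<cdot> mk \<cdot> copy \<cdot> copy \<cdot>
          (\<Lambda> x:X. \<Lambda> y:X. \<Lambda> f:(car \<cdot> x \<rightarrow> car \<cdot> y). \<Lambda> g:(car \<cdot> y \<rightarrow> car \<cdot> x).
            ext \<cdot> univ v \<cdot> (\<Lambda> Q:univ v. B Q) \<cdot> (\<Lambda> Q:univ v. B_prop Q) \<cdot> x \<cdot> y \<cdot>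
              (con (CPropext v) \<cdot> (car \<cdot> x) \<cdot> (car \<cdot> y) \<cdot> (car_prop \<cdot> x) \<cdot> (car_prop \<cdot> y) \<cdot> f \<cdot> g)))"

definition tarski_resizing :: "'l::universe_level \<Rightarrow> 'l \<Rightarrow> 'l dtm" where
  "tarski_resizing u v = Tarskis_Theorem v (usuc v \<squnion> u) v \<rightarrow> Propositional_Resizing u v"

section \<open>Checking the proof terms\<close>

text \<open>Evaluation has two stages: definitions are unfolded to raw terms with unary indices and
  concrete levels, and only then is the checker run.\<close>

lemmas dtm_defs = pi_def lam_def app_def univ_def con_def arrow_def sigma_def prod_def eqt_def
  is_prop_def bound_def minus_nat.diff_0 diff_Suc_Suc diff_0_eq_0

lemmas term_defs = tarski_resizing_def prop_is_set_def subtype_ext_def prop_equivalence_def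
  small_parts_def resized_def equivalent_def is_equiv_def fiber_def is_contr_def
  Propositional_Resizing_def Tarskis_Theorem_def is_poset_def has_sups_def is_sup_def
  greatest_fixed_point_def monotone_endo_def antisymmetric_def transitive_def reflexive_def
  prop_valued_def order_of_def pair_def split_def proj1_def prod_snd_def rfl_def path_ind_def
  cancel_def prop_pi_def unit_prop_def poset_proof_def sups_proof_def Let_def sup_lev_Lev
  usuc_lev_Lev max_0L max_0R max_Suc_Suc bump.simps numeral_eq_Suc pred_numeral_simps One_nat_def
  BitM.simps numeral_One

text \<open>The types of the constants are unfolded once, with symbolic levels, so that a run only
  instantiates them.\<close>

lemmas cty_0 = cty.simps[THEN fun_cong, where x = 0, simplified dtm_defs]

lemmas checker_simps =
  shift.simps lift_by.simps subst_var.simps subst_at.simps spine.simps guard.simps iota_pair.simps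
  iota_refl.simps iota_const.simps iota.simps elim_arity.simps elim_spine.simps answer_univ.simps
  as_univ.simps answer_pi.simps as_pi.simps univ_of.simps sort_of_def eq_sort_def conv_unless.simps
  conv_def answer_conv.simps check_def lookup.simps pi_sort.simps lam_type.simps app_type.simps
  infer_app.simps infer.simps beta.simps retype.simps red_arg'.simps answer_as_pi.simps red_arg.simps
  red_fun'.simps red_fun.simps red_neutral.simps red_spine.simps red_app.simps red.simps eqv_arg'.simps
  eqv_arg.simps eqv_app.simps eqv_at.simps eqv_from.simps eqv_right.simps eqv_left.simps eqv.simps
  eqv_unless.simps with_term.simps whd_again.simps whd.simps step.simps run.simps cty_0
  tm.inject tm.distinct const.inject const.distinct lev.inject nat.inject nat.distinct list.size
  Option.is_none_simps simp_thms sup_lev_Lev usuc_lev_Lev max_0L max_0R max_Suc_Suc bump.simps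
  add_0 add_Suc minus_nat.diff_0 diff_Suc_Suc diff_0_eq_0

lemma (in level_hom) map_tm_tarski_resizing:
  "map_tm f (tarski_resizing u v 0) = tarski_resizing (f u) (f v) 0"
  by (simp add: term_defs dtm_defs f_sup f_usuc)

lemma (in level_hom) holds_map:
  "holds (tarski_resizing u v) \<Longrightarrow> holds (tarski_resizing (f u) (f v))"
  unfolding holds_def using derivation_map(2)[of "[]" _ "tarski_resizing u v 0"]
  by (auto simp: map_tm_tarski_resizing)

section \<open>Closed inhabitants at the generic levels\<close>

lemma holds_prop_is_set: "holds (prop_is_set gen_v)"
  by (rule holds_if_check[where n = 50 and t = "prop_is_set_proof gen_v"])
    (simp only: term_defs prop_is_set_proof_def dtm_defs, simp only: checker_simps)

text \<open>Levels are concrete in a run, so each use has its own instance: fibres of a map from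
  \<open>P\<close>, small parts over the universe, and pairs of a propositionality proof and a map
  into \<open>P\<close>.\<close>

lemma holds_subtype_ext:
  "holds (subtype_ext gen_u gen_v)"
  "holds (subtype_ext (usuc gen_v) (gen_v \<squnion> gen_u))"
  "holds (subtype_ext gen_v (gen_v \<squnion> gen_u))"
proof -
  show "holds (subtype_ext gen_u gen_v)"
    by (rule holds_if_check[where n = 45 and t = "subtype_ext_proof gen_u gen_v"])
      (simp only: term_defs subtype_ext_proof_def dtm_defs, simp only: checker_simps)
  show "holds (subtype_ext (usuc gen_v) (gen_v \<squnion> gen_u))"
    by (rule holds_if_check[where n = 45 and t = "subtype_ext_proof (usuc gen_v) (gen_v \<squnion> gen_u)"])
      (simp only: term_defs subtype_ext_proof_def dtm_defs, simp only: checker_simps)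
  show "holds (subtype_ext gen_v (gen_v \<squnion> gen_u))"
    by (rule holds_if_check[where n = 45 and t = "subtype_ext_proof gen_v (gen_v \<squnion> gen_u)"])
      (simp only: term_defs subtype_ext_proof_def dtm_defs, simp only: checker_simps)
qed

lemma holds_prop_equivalence: "holds (prop_equivalence gen_u gen_v)"
proof -
  \<comment> \<open>Earlier results enter as hypotheses, hence as variables of the checked term;
    their proof terms are not evaluated again.\<close>
  have "holds (prop_is_set gen_v \<rightarrow> subtype_ext gen_u gen_v \<rightarrow> prop_equivalence gen_u gen_v)"
    by (rule holds_if_check[where n = 35 and t = "prop_equivalence_proof gen_u gen_v"])
      (simp only: term_defs prop_equivalence_proof_def dtm_defs, simp only: checker_simps)
  then have "holds (subtype_ext gen_u gen_v \<rightarrow> prop_equivalence gen_u gen_v)"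
    by (rule holds_mp[OF _ holds_prop_is_set])
      (simp only: term_defs dtm_defs subst_at_0[symmetric], simp only: checker_simps)
  then show ?thesis
    by (rule holds_mp[OF _ holds_subtype_ext(1)])
      (simp only: term_defs dtm_defs subst_at_0[symmetric], simp only: checker_simps)
qed

lemma holds_small_parts: "holds (small_parts gen_u gen_v)"
proof -
  have "holds (prop_equivalence gen_u gen_v \<rightarrow> small_parts gen_u gen_v)"
    by (rule holds_if_check[where n = 46 and t = "small_parts_proof gen_u gen_v"])
      (simp only: term_defs small_parts_proof_def dtm_defs, simp only: checker_simps)
  then show ?thesis
    by (rule holds_mp[OF _ holds_prop_equivalence])
      (simp only: term_defs dtm_defs subst_at_0[symmetric], simp only: checker_simps)
qed

lemma holds_generic_resizing: "holds (tarski_resizing gen_u gen_v)"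
proof -
  let ?ext = "subtype_ext (usuc gen_v) (gen_v \<squnion> gen_u)" and ?ext' = "subtype_ext gen_v (gen_v \<squnion> gen_u)"
  have "holds (prop_is_set gen_v \<rightarrow> ?ext \<rightarrow> ?ext' \<rightarrow> small_parts gen_u gen_v \<rightarrow> tarski_resizing gen_u gen_v)"
    by (rule holds_if_check[where n = 54 and t = "resizing_proof gen_u gen_v"])
      (simp only: term_defs resizing_proof_def dtm_defs, simp only: checker_simps)
  then have "holds (?ext \<rightarrow> ?ext' \<rightarrow> small_parts gen_u gen_v \<rightarrow> tarski_resizing gen_u gen_v)"
    by (rule holds_mp[OF _ holds_prop_is_set])
      (simp only: term_defs dtm_defs subst_at_0[symmetric], simp only: checker_simps)
  then have "holds (?ext' \<rightarrow> small_parts gen_u gen_v \<rightarrow> tarski_resizing gen_u gen_v)"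
    by (rule holds_mp[OF _ holds_subtype_ext(2)])
      (simp only: term_defs dtm_defs subst_at_0[symmetric], simp only: checker_simps)
  then have "holds (small_parts gen_u gen_v \<rightarrow> tarski_resizing gen_u gen_v)"
    by (rule holds_mp[OF _ holds_subtype_ext(3)])
      (simp only: term_defs dtm_defs subst_at_0[symmetric], simp only: checker_simps)
  then show ?thesis
    by (rule holds_mp[OF _ holds_small_parts])
      (simp only: term_defs dtm_defs subst_at_0[symmetric], simp only: checker_simps)
qed

text \<open>The generic derivation is transported along the homomorphism that sends the two
  generators to \<open>u\<close> and \<open>v\<close>.\<close>

lemma holds_tarski_resizing: "holds (tarski_resizing u (v :: 'l::universe_level))"
proof -
  interpret level_hom "interp u v"
    by (rule level_hom_interp)
  show ?thesis
    using holds_map[OF holds_generic_resizing] by (simp add: iter_def)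
qed

text \<open>The second conjunct is the case where \<U> is the successor of \<V>; the join then
  collapses by idempotence.\<close>

theorem theorem5p6:
  fixes \<U> \<V> :: "'l::universe_level"
  shows "holds (Tarskis_Theorem \<V> (usuc \<V> \<squnion> \<U>) \<V> \<rightarrow> Propositional_Resizing \<U> \<V>) \<and>
         holds (Tarskis_Theorem \<V> (usuc \<V>) \<V> \<rightarrow> Propositional_Resizing (usuc \<V>) \<V>)"
  using holds_tarski_resizing[of \<U> \<V>] holds_tarski_resizing[of "usuc \<V>" \<V>]
  by (simp add: tarski_resizing_def)

end
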